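(* Let $B$ be a bounded positive operator on the complex Hilbert space $\mathcal{H}$. The mapping $\Psi_B(P):=J_BPJ_B^*$ establishes an order preserving bijection between the set $\mathbf{P}(\mathcal{H}_B)$ of orthogonal projections on $\mathcal{H}_B$ and the set $\mathrm{Q}(B)$ of $B$-quasi-units.
   Context: A bounded linear operator $A$ on $\mathcal{H}$ is positive, $A\in\mathbf{B}_+(\mathcal{H})$, if $(Ax\,|\,x)\geq 0$ for all $x\in\mathcal{H}$; $A\leq B$ means $B-A$ is positive. Both $\mathbf{P}(\mathcal{H}_B)$ and $\mathrm{Q}(B)$ carry the order $\leq$ of positive operators (on $\mathcal{H}_B$ and $\mathcal{H}$ respectively). Parallel sum: for $A,B\in\mathbf{B}_+(\mathcal{H})$, $A:B$ is the unique positive operator with $((A:B)x\,|\,x)=\inf_{y\in\mathcal{H}}\{(A(x-y)\,|\,x-y)+(By\,|\,y)\}$ for all $x\in\mathcal{H}$. Generalized short: $[A]B:=\sup_{n\in\mathbb{N}}B:(nA)$, the strong limit of the increasing sequence $(B:(nA))_n$, which is bounded above by $B$. Quasi-unit: a positive operator $A$ with $0\leq A\leq B$ is a $B$-quasi-unit if $A=[A]B$. $\mathrm{Q}(B)$ is the set of all $B$-quasi-units. Auxiliary space: for $B\in\mathbf{B}_+(\mathcal{H})$, $\mathcal{H}_B$ is the Hilbert space completion of $\operatorname{ran}B$ with the inner product $\langle Bx\,|\,By\rangle_B=(Bx\,|\,y)$, $x,y\in\mathcal{H}$. The operator $J_B:\mathcal{H}_B\to\mathcal{H}$ is the bounded extension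 of the map $Bx\mapsto Bx$ from $\operatorname{ran}B\subseteq\mathcal{H}_B$ to $\mathcal{H}$; its adjoint $J_B^*:\mathcal{H}\to\mathcal{H}_B$ satisfies $J_B^*x=Bx$ for $x\in\mathcal{H}$, and $J_BJ_B^*=B$. *)

theory Defs
  imports "HOL-Analysis.Analysis"
begin

section \<open>Complex Hilbert spaces\<close>

text \<open>
  The libraries only have real inner product spaces. A complex inner product space is a
  \<^class>\<open>real_inner\<close> space with a compatible complex structure; the complex inner product
  is linear in its first argument. Since the real inner product is the real part of the complex
  one, \<open>cinner x x\<close> is a nonnegative real that vanishes only for \<open>x = 0\<close>, and the norm of the
  type is the Hilbert norm.
\<close>

class scaleC =
  fixes scaleC :: "complex \<Rightarrow> 'a \<Rightarrow> 'a" (infixr "*\<^sub>C" 75)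

class cinner =
  fixes cinner :: "'a \<Rightarrow> 'a \<Rightarrow> complex"

class complex_inner = real_inner + scaleC + cinner +
  assumes scaleC_add_right: "c *\<^sub>C (x + y) = c *\<^sub>C x + c *\<^sub>C y"
    and scaleC_add_left: "(c + d) *\<^sub>C x = c *\<^sub>C x + d *\<^sub>C x"
    and scaleC_scaleC: "c *\<^sub>C d *\<^sub>C x = (c * d) *\<^sub>C x"
    and scaleR_scaleC: "r *\<^sub>R x = complex_of_real r *\<^sub>C x"
    and cinner_commute: "cinner x y = cnj (cinner y x)"
    and cinner_add_left: "cinner (x + y) z = cinner x z + cinner y z"
    and cinner_scaleC_left: "cinner (c *\<^sub>C x) y = c * cinner x y"
    and inner_eq_Re_cinner: "inner x y = Re (cinner x y)"

class chilbert_space = complex_inner + complete_space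

instantiation complex :: chilbert_space
begin

definition scaleC_complex :: "complex \<Rightarrow> complex \<Rightarrow> complex"
  where "scaleC_complex c x = c * x"

definition cinner_complex :: "complex \<Rightarrow> complex \<Rightarrow> complex"
  where "cinner_complex x y = x * cnj y"

instance
  by standard
    (auto simp: scaleC_complex_def cinner_complex_def algebra_simps scaleR_conv_of_real
      inner_complex_def)

end


section \<open>Operators between closed subspaces\<close>

text \<open>
  The auxiliary Hilbert space depends on an operator, so it cannot be a type of its own.
  Hilbert spaces are therefore represented as closed complex subspaces \<open>V\<close> of a type of class
  \<^class>\<open>chilbert_space\<close> (with \<open>V = UNIV\<close> for the whole type). An operator on \<open>V\<close> is an
  extensional function (undefined outside \<open>V\<close>), so that equality of operators is equality on \<open>V\<close>.
\<close>

definition closed_csubspace :: "'a::chilbert_space set \<Rightarrow> bool" where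
  "closed_csubspace V \<longleftrightarrow>
     0 \<in> V \<and> (\<forall>x\<in>V. \<forall>y\<in>V. x + y \<in> V) \<and> (\<forall>c. \<forall>x\<in>V. c *\<^sub>C x \<in> V) \<and> closed V"

definition clinear_on :: "'a::chilbert_space set \<Rightarrow> ('a \<Rightarrow> 'b::chilbert_space) \<Rightarrow> bool" where
  "clinear_on V T \<longleftrightarrow>
     (\<forall>x\<in>V. \<forall>y\<in>V. T (x + y) = T x + T y) \<and> (\<forall>c. \<forall>x\<in>V. T (c *\<^sub>C x) = c *\<^sub>C T x)"

definition bounded_ops ::
    "'a::chilbert_space set \<Rightarrow> 'b::chilbert_space set \<Rightarrow> ('a \<Rightarrow> 'b) set" where
  "bounded_ops V W =
     {T \<in> V \<rightarrow>\<^sub>E W. clinear_on V T \<and> (\<exists>M. \<forall>x\<in>V. norm (T x) \<le> M * norm x)}"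

definition adjoint_op ::
    "'a::chilbert_space set \<Rightarrow> 'b::chilbert_space set \<Rightarrow> ('a \<Rightarrow> 'b) \<Rightarrow> 'b \<Rightarrow> 'a" where
  "adjoint_op V W T =
     (THE S. S \<in> bounded_ops W V \<and> (\<forall>x\<in>V. \<forall>y\<in>W. cinner (T x) y = cinner x (S y)))"

definition positive_ops :: "'a::chilbert_space set \<Rightarrow> ('a \<Rightarrow> 'a) set" where
  "positive_ops V = {A \<in> bounded_ops V V. \<forall>x\<in>V. cinner (A x) x \<in> \<real>\<^sub>\<ge>\<^sub>0}"

definition op_le :: "'a::chilbert_space set \<Rightarrow> ('a \<Rightarrow> 'a) \<Rightarrow> ('a \<Rightarrow> 'a) \<Rightarrow> bool" where
  "op_le V A B \<longleftrightarrow> (\<lambda>x\<in>V. B x - A x) \<in> positive_ops V"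

definition orth_projections :: "'a::chilbert_space set \<Rightarrow> ('a \<Rightarrow> 'a) set" where
  "orth_projections V =
     {P \<in> bounded_ops V V. (\<forall>x\<in>V. P (P x) = P x) \<and>
        (\<forall>x\<in>V. \<forall>y\<in>V. cinner (P x) y = cinner x (P y))}"


section \<open>Parallel sum, generalized short and quasi-units\<close>

definition parallel_sum ::
    "('a::chilbert_space \<Rightarrow> 'a) \<Rightarrow> ('a \<Rightarrow> 'a) \<Rightarrow> 'a \<Rightarrow> 'a" where
  "parallel_sum A B =
     (THE C. C \<in> positive_ops UNIV \<and>
        (\<forall>x. cinner (C x) x =
           complex_of_real
             (INF y. Re (cinner (A (x - y)) (x - y)) + Re (cinner (B y) y))))"

text \<open>The generalized short \<open>[A]B\<close> is the strong (pointwise) limit of \<open>B : (nA)\<close>.\<close>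

definition gen_short ::
    "('a::chilbert_space \<Rightarrow> 'a) \<Rightarrow> ('a \<Rightarrow> 'a) \<Rightarrow> 'a \<Rightarrow> 'a" where
  "gen_short A B = (\<lambda>x. lim (\<lambda>n. parallel_sum B (\<lambda>y. of_nat n *\<^sub>C A y) x))"

definition quasi_units :: "('a::chilbert_space \<Rightarrow> 'a) \<Rightarrow> ('a \<Rightarrow> 'a) set" where
  "quasi_units B = {A \<in> positive_ops UNIV. op_le UNIV A B \<and> A = gen_short A B}"


section \<open>The auxiliary space\<close>

text \<open>
  \<open>aux_space B K \<iota>\<close>: the Hilbert space \<open>K\<close> together with the embedding \<open>\<iota>\<close> is a completion of
  \<open>range B\<close> with the inner product \<open>\<langle>B x | B y\<rangle> = (B x | y)\<close>. Only the values of \<open>\<iota>\<close> on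
  \<open>range B\<close> matter. A completion always exists even within \<open>'k = 'a\<close>: take the closure of
  \<open>range B\<close> and let \<open>\<iota>\<close> send \<open>B x\<close> to the value at \<open>x\<close> of the positive square root of \<open>B\<close>.
\<close>

definition aux_space ::
    "('a::chilbert_space \<Rightarrow> 'a) \<Rightarrow> 'k::chilbert_space set \<Rightarrow> ('a \<Rightarrow> 'k) \<Rightarrow> bool" where
  "aux_space B K \<iota> \<longleftrightarrow>
     closed_csubspace K \<and> clinear_on (range B) \<iota> \<and>
     (\<forall>x y. cinner (\<iota> (B x)) (\<iota> (B y)) = cinner (B x) y) \<and>
     closure (\<iota> ` range B) = K"

text \<open>\<open>J_op\<close> is the bounded extension to \<open>K\<close> of the identity map on \<open>range B\<close>.\<close>

definition J_op ::
    "('a::chilbert_space \<Rightarrow> 'a) \<Rightarrow> 'k::chilbert_space set \<Rightarrow> ('a \<Rightarrow> 'k) \<Rightarrow> 'k \<Rightarrow> 'a" where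
  "J_op B K \<iota> = (THE J. J \<in> bounded_ops K UNIV \<and> (\<forall>x. J (\<iota> (B x)) = B x))"

definition Psi ::
    "('a::chilbert_space \<Rightarrow> 'a) \<Rightarrow> 'k::chilbert_space set \<Rightarrow> ('a \<Rightarrow> 'k) \<Rightarrow>
      ('k \<Rightarrow> 'k) \<Rightarrow> 'a \<Rightarrow> 'a" where
  "Psi B K \<iota> P = J_op B K \<iota> \<circ> P \<circ> adjoint_op K UNIV (J_op B K \<iota>)"

end

theory Submission
  imports Defs
begin

text \<open>
  Put \<open>j x = \<iota> (B x) = J\<^sup>* x\<close>, so that the form of \<open>J T J\<^sup>*\<close> at \<open>x\<close> is that of \<open>T\<close> at
  \<open>j x\<close>. As \<open>range j\<close> is dense in \<open>K\<close>, the map \<open>T \<mapsto> J T J\<^sup>*\<close> is injective and order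
  reflecting, it reaches every \<open>A\<close> with \<open>0 \<le> A \<le> B\<close>, and it carries the parallel sum \<open>I : n T\<close>
  computed in \<open>K\<close> to \<open>B : n A\<close>. There \<open>I : n T = n T (I + n T)\<^sup>-\<^sup>1\<close> converges strongly to the
  projection \<open>P\<close> onto the closure of the range of \<open>T\<close>. Hence \<open>[A]B = J P J\<^sup>*\<close>, which equals \<open>A\<close>
  if \<open>T\<close> is a projection; conversely every quasi-unit has this form.
\<close>

section \<open>Complex inner product spaces\<close>

text \<open>The infimum in a parallel sum runs over vectors of H, and the values of
  \<open>\<iota>\<close> are known only on \<open>range B\<close>. So \<open>K\<close> is accessible
  only through its dense subset \<open>range j\<close>: vectors and operators of \<open>K\<close>
  are compared by inner products with \<open>j x\<close>, and inequalities pass to \<open>K\<close>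
  by continuity. Neither an inverse of I + n T nor a square root is ever formed. \<open>J\<close>,
  the operators I : n T, the projection onto the closure of a range and the preimage
  \<open>T\<close> of a given \<open>A\<close> all arise in one way: a map is dominated in norm by
  another one, and Douglas' lemma returns the adjoint of the induced bounded map. These adjoints are
  defined on the whole type and then restricted to \<open>K\<close>, because an operator on
  \<open>K\<close> must be extensional. What an inverse would give is replaced by the equation S + n
  T S = n T together with injectivity of I + n T.\<close>

lemma cinner_add_right:
  "cinner x (y + z) = cinner x y + cinner x z" for x :: "'a::complex_inner"
  by (metis cinner_add_left cinner_commute complex_cnj_add)

lemma cinner_scaleC_right:
  "cinner x (c *\<^sub>C y) = cnj c * cinner x y" for x :: "'a::complex_inner"
  by (metis cinner_commute cinner_scaleC_left complex_cnj_mult)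

text \<open>The second slot is conjugate linear, so the imaginary part of \<open>cinner x y\<close>
  is the real part of \<open>cinner x (\<i> *\<^sub>C y)\<close>. For complex linear maps it
  therefore suffices to verify identities for the real \<open>inner\<close>.\<close>

lemma cinner_eq_Complex:
  "cinner x y = Complex (inner x y) (inner x (\<i> *\<^sub>C y))" for x :: "'a::complex_inner"
  by (simp add: complex_eq_iff inner_eq_Re_cinner cinner_scaleC_right)

lemma inner_scaleC_left:
  "inner (c *\<^sub>C x) y = inner x (cnj c *\<^sub>C y)" for x :: "'a::complex_inner"
  by (simp add: inner_eq_Re_cinner cinner_scaleC_left cinner_scaleC_right)

lemma cinner_self: "cinner x x = complex_of_real ((norm x)\<^sup>2)" for x :: "'a::complex_inner"
proof -
  have "Im (cinner x x) = 0"
    using cinner_commute[of x x] by (simp add: complex_eq_iff)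
  then show ?thesis
    by (simp add: complex_eq_iff power2_norm_eq_inner inner_eq_Re_cinner)
qed

lemma scaleC_zero_right [simp]: "c *\<^sub>C 0 = (0::'a::complex_inner)"
  using scaleC_add_right[of c 0 "0::'a"] by simp

lemma scaleC_minus_right [simp]: "c *\<^sub>C (- x) = - (c *\<^sub>C (x::'a::complex_inner))"
  by (metis add.right_inverse add_eq_0_iff scaleC_add_right scaleC_zero_right)

lemma scaleC_diff_right: "c *\<^sub>C (x - y) = c *\<^sub>C x - c *\<^sub>C (y::'a::complex_inner)"
  using scaleC_add_right[of c x "- y"] by simp

lemma cinner_diff_left:
  "cinner (x - y) z = cinner x z - cinner y z" for x :: "'a::complex_inner"
  using cinner_add_left[of "x - y" y z] by simp

lemma cinner_diff_right:
  "cinner z (x - y) = cinner z x - cinner z y" for x :: "'a::complex_inner"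
  using cinner_add_right[of z "x - y" y] by simp

lemma scaleC_left_commute: "c *\<^sub>C d *\<^sub>C x = d *\<^sub>C c *\<^sub>C (x::'a::complex_inner)"
  by (simp add: scaleC_scaleC mult.commute)

lemma norm_scaleC: "norm (c *\<^sub>C x) = cmod c * norm (x::'a::complex_inner)"
proof -
  have "complex_of_real ((norm (c *\<^sub>C x))\<^sup>2) = (c * cnj c) * cinner x x"
    by (simp only: cinner_self[symmetric] cinner_scaleC_left cinner_scaleC_right ac_simps)
  also have "\<dots> = complex_of_real ((cmod c * norm x)\<^sup>2)"
    by (simp add: cinner_self complex_norm_square[symmetric] power_mult_distrib)
  finally have "(norm (c *\<^sub>C x))\<^sup>2 = (cmod c * norm x)\<^sup>2"
    unfolding of_real_eq_iff .
  then show ?thesis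
    by simp
qed

lemma in_Reals_nonneg_iff:
  "z \<in> \<real>\<^sub>\<ge>\<^sub>0 \<longleftrightarrow> 0 \<le> Re z \<and> Im z = 0"
  by (simp add: complex_nonneg_Reals_iff)


section \<open>Bounded operators on closed subspaces\<close>

lemma closed_csubspace_UNIV [simp]: "closed_csubspace UNIV"
  by (simp add: closed_csubspace_def)

lemma subspace_if_closed_csubspace: "closed_csubspace V \<Longrightarrow> subspace V"
  by (simp add: closed_csubspace_def subspace_def scaleR_scaleC)

lemma clinear_onD:
  assumes "clinear_on V T"
  shows "x \<in> V \<Longrightarrow> y \<in> V \<Longrightarrow> T (x + y) = T x + T y"
    and "x \<in> V \<Longrightarrow> T (c *\<^sub>C x) = c *\<^sub>C T x"
  using assms by (auto simp: clinear_on_def)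

lemma linear_if_clinear: "clinear_on UNIV T \<Longrightarrow> linear T"
  by (auto simp: clinear_on_def scaleR_scaleC intro: linearI)

lemma bounded_opsD:
  assumes "T \<in> bounded_ops V W" "closed_csubspace V"
  shows "x \<in> V \<Longrightarrow> T x \<in> W"
    and "x \<in> V \<Longrightarrow> y \<in> V \<Longrightarrow> T (x + y) = T x + T y"
    and "x \<in> V \<Longrightarrow> y \<in> V \<Longrightarrow> T (x - y) = T x - T y"
    and "x \<in> V \<Longrightarrow> T (c *\<^sub>C x) = c *\<^sub>C T x"
    and "x \<in> V \<Longrightarrow> T (r *\<^sub>R x) = r *\<^sub>R T x"
proof -
  note T = assms[unfolded bounded_ops_def closed_csubspace_def clinear_on_def]
  show "x \<in> V \<Longrightarrow> T x \<in> W" for x using T by auto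
  show add: "x \<in> V \<Longrightarrow> y \<in> V \<Longrightarrow> T (x + y) = T x + T y" for x y using T by auto
  show "x \<in> V \<Longrightarrow> T (c *\<^sub>C x) = c *\<^sub>C T x" for x c using T by auto
  show "x \<in> V \<Longrightarrow> T (r *\<^sub>R x) = r *\<^sub>R T x" for x r using T by (auto simp: scaleR_scaleC)
  show "T (x - y) = T x - T y" if "x \<in> V" "y \<in> V"
    using add[of "x - y" y] that subspace_diff[OF subspace_if_closed_csubspace[OF assms(2)]]
    by simp
qed

lemma bounded_ops_bound:
  assumes "T \<in> bounded_ops V W"
  obtains M where "M \<ge> 0" "\<And>x. x \<in> V \<Longrightarrow> norm (T x) \<le> M * norm x"
proof -
  obtain M where M: "\<And>x. x \<in> V \<Longrightarrow> norm (T x) \<le> M * norm x"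
    using assms by (auto simp: bounded_ops_def)
  have "norm (T x) \<le> \<bar>M\<bar> * norm x" if "x \<in> V" for x
    by (rule order_trans[OF M[OF that]]) (simp add: mult_right_mono)
  then show ?thesis using that[of "\<bar>M\<bar>"] by auto
qed

lemma bounded_opsI:
  assumes "\<And>x. x \<in> V \<Longrightarrow> T x \<in> W"
    and "\<And>x. x \<notin> V \<Longrightarrow> T x = undefined"
    and "\<And>x y. x \<in> V \<Longrightarrow> y \<in> V \<Longrightarrow> T (x + y) = T x + T y"
    and "\<And>c x. x \<in> V \<Longrightarrow> T (c *\<^sub>C x) = c *\<^sub>C T x"
    and "\<And>x. x \<in> V \<Longrightarrow> norm (T x) \<le> M * norm x"
  shows "T \<in> bounded_ops V W"
proof -
  have "T \<in> V \<rightarrow>\<^sub>E W" "clinear_on V T"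
    using assms(1-4) by (auto simp: clinear_on_def)
  with assms(5) show ?thesis unfolding bounded_ops_def by blast
qed

lemma bounded_ops_eqI:
  assumes "S \<in> bounded_ops V W" "T \<in> bounded_ops V W'" "\<And>x. x \<in> V \<Longrightarrow> S x = T x"
  shows "S = T"
proof (rule extensionalityI)
  show "S \<in> extensional V" "T \<in> extensional V"
    using assms(1,2) by (auto simp: bounded_ops_def PiE_def)
qed (rule assms(3))

lemma bounded_ops_restrict:
  assumes "T \<in> bounded_ops UNIV UNIV" "closed_csubspace V" "\<And>x. x \<in> V \<Longrightarrow> T x \<in> W"
  shows "restrict T V \<in> bounded_ops V W"
proof -
  obtain M where M: "\<And>x. norm (T x) \<le> M * norm x"
    using assms(1) by (auto simp: bounded_ops_def)
  have V: "x + y \<in> V" "c *\<^sub>C x \<in> V" if "x \<in> V" "y \<in> V" for x y c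
    using assms(2) that by (auto simp: closed_csubspace_def)
  note T = bounded_opsD[OF assms(1) closed_csubspace_UNIV]
  show ?thesis
    by (rule bounded_opsI[of _ _ _ M]) (simp_all add: assms(3) V M T(2,4))
qed

lemma bounded_ops_scaled:
  assumes "T \<in> bounded_ops V W" "closed_csubspace V" "closed_csubspace W"
  shows "(\<lambda>x\<in>V. c *\<^sub>C T x) \<in> bounded_ops V W"
proof -
  obtain M where M: "\<And>x. x \<in> V \<Longrightarrow> norm (T x) \<le> M * norm x"
    using bounded_ops_bound[OF assms(1)] by blast
  have V: "x + y \<in> V" "d *\<^sub>C x \<in> V" if "x \<in> V" "y \<in> V" for x y d
    using assms(2) that by (auto simp: closed_csubspace_def)
  have W: "c *\<^sub>C x \<in> W" if "x \<in> W" for x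
    using assms(3) that by (auto simp: closed_csubspace_def)
  note T = bounded_opsD[OF assms(1,2)]
  show ?thesis
  proof (rule bounded_opsI[of _ _ _ "cmod c * M"])
    fix x d assume "x \<in> V"
    then show "(\<lambda>x\<in>V. c *\<^sub>C T x) (d *\<^sub>C x) = d *\<^sub>C (\<lambda>x\<in>V. c *\<^sub>C T x) x"
      by (simp add: V T(4) scaleC_left_commute)
    show "norm ((\<lambda>x\<in>V. c *\<^sub>C T x) x) \<le> cmod c * M * norm x"
      using M[OF \<open>x \<in> V\<close>] \<open>x \<in> V\<close> by (simp add: norm_scaleC mult.assoc mult_left_mono)
  qed (simp_all add: V W T(1,2) scaleC_add_right)
qed

lemma bounded_ops_diff:
  assumes "S \<in> bounded_ops V W" "T \<in> bounded_ops V W" "closed_csubspace V" "closed_csubspace W"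
  shows "(\<lambda>x\<in>V. S x - T x) \<in> bounded_ops V W"
proof -
  obtain M where M: "\<And>x. x \<in> V \<Longrightarrow> norm (S x) \<le> M * norm x"
    using bounded_ops_bound[OF assms(1)] by blast
  obtain N where N: "\<And>x. x \<in> V \<Longrightarrow> norm (T x) \<le> N * norm x"
    using bounded_ops_bound[OF assms(2)] by blast
  have "norm (S x - T x) \<le> (M + N) * norm x" if "x \<in> V" for x
    using M[OF that] N[OF that] norm_triangle_ineq4[of "S x" "T x"] by (simp add: algebra_simps)
  then show ?thesis
    using assms(3,4) subspace_diff[OF subspace_if_closed_csubspace[OF assms(4)]]
    by (intro bounded_opsI[of _ _ _ "M + N"])
      (auto simp: bounded_opsD[OF assms(1,3)] bounded_opsD[OF assms(2,3)] closed_csubspace_def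
        scaleC_diff_right)
qed

lemma bounded_ops_tendsto:
  assumes "T \<in> bounded_ops V W" "closed_csubspace V" "\<And>n. X n \<in> V" "x \<in> V" "X \<longlonglongrightarrow> x"
  shows "(\<lambda>n. T (X n)) \<longlonglongrightarrow> T x"
proof -
  obtain M where M: "\<And>x. x \<in> V \<Longrightarrow> norm (T x) \<le> M * norm x"
    using bounded_ops_bound[OF assms(1)] by blast
  have lim: "(\<lambda>n. M * norm (X n - x)) \<longlonglongrightarrow> 0"
    using tendsto_mult_left[OF tendsto_norm_zero[OF LIM_zero[OF assms(5)]], of M] by simp
  have bound: "norm (T (X n) - T x) \<le> M * norm (X n - x)" for n
    using M[of "X n - x"] bounded_opsD(3)[OF assms(1,2) assms(3)[of n] assms(4)]
      subspace_diff[OF subspace_if_closed_csubspace[OF assms(2)] assms(3)[of n] assms(4)]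
    by simp
  have "(\<lambda>n. T (X n) - T x) \<longlonglongrightarrow> 0"
    by (rule Lim_null_comparison[OF _ lim]) (simp add: bound)
  then show ?thesis by (rule LIM_zero_cancel)
qed

section \<open>Positive operators: symmetry, Cauchy-Schwarz, determination by the form\<close>

text \<open>The form of a positive operator is real, so
  \<open>inner (A z) (\<i> *\<^sub>C z)\<close>, its imaginary part, vanishes at every z. At z = x -
  i y the two cross terms that survive are \<open>inner (A x) y\<close> and
  \<open>- inner x (A y)\<close>; the factor -i is chosen so that i (-i) = 1 produces the first one.
  Complex scalars are essential here.\<close>

lemma positive_ops_symmetric:
  assumes "A \<in> positive_ops V" "closed_csubspace V" "x \<in> V" "y \<in> V"
  shows "inner (A x) y = inner x (A y)"
proof -
  have A: "A \<in> bounded_ops V V" and real: "\<And>z. z \<in> V \<Longrightarrow> Im (cinner (A z) z) = 0"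
    using assms(1) by (auto simp: positive_ops_def in_Reals_nonneg_iff)
  note [simp] = bounded_opsD[OF A assms(2)]
  have V: "c *\<^sub>C z \<in> V" "z + w \<in> V" if "z \<in> V" "w \<in> V" for c z w
    using assms(2) that by (auto simp: closed_csubspace_def)
  have re: "inner (A z) (\<i> *\<^sub>C z) = 0" if "z \<in> V" for z
    using real[OF that] by (simp add: cinner_eq_Complex)
  have "inner (A (x + (- \<i>) *\<^sub>C y)) (\<i> *\<^sub>C (x + (- \<i>) *\<^sub>C y)) = 0"
    using assms V by (intro re) auto
  moreover have "inner (A ((- \<i>) *\<^sub>C y)) (\<i> *\<^sub>C ((- \<i>) *\<^sub>C y)) = 0"
    using assms V by (intro re) auto
  ultimately have "inner (A x) (\<i> *\<^sub>C (- \<i>) *\<^sub>C y) + inner (A ((- \<i>) *\<^sub>C y)) (\<i> *\<^sub>C x) = 0"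
    using re[OF assms(3)] assms(3,4) V
    by (simp add: inner_add_left inner_add_right scaleC_add_right)
  moreover have "\<i> *\<^sub>C (- \<i>) *\<^sub>C y = y"
    using scaleR_scaleC[of 1 y] by (simp add: scaleC_scaleC)
  moreover have "inner (A ((- \<i>) *\<^sub>C y)) (\<i> *\<^sub>C x) = - inner x (A y)"
  proof -
    have "inner ((- \<i>) *\<^sub>C A y) (\<i> *\<^sub>C x) = inner (A y) ((-1) *\<^sub>C x)"
      by (simp add: inner_scaleC_left scaleC_scaleC)
    moreover have "(-1) *\<^sub>C x = - x"
      using scaleR_scaleC[of "-1" x] by simp
    moreover have "A ((- \<i>) *\<^sub>C y) = (- \<i>) *\<^sub>C A y"
      using assms(4) by simp
    ultimately show ?thesis
      by (simp only: inner_minus_right inner_commute)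
  qed
  ultimately show ?thesis by simp
qed

lemma positive_opsD:
  assumes "A \<in> positive_ops V"
  shows "A \<in> bounded_ops V V"
    and "x \<in> V \<Longrightarrow> inner (A x) x \<ge> 0"
    and "x \<in> V \<Longrightarrow> cinner (A x) x = complex_of_real (inner (A x) x)"
  using assms by (auto simp: positive_ops_def in_Reals_nonneg_iff inner_eq_Re_cinner complex_eq_iff)

text \<open>The form is nonnegative at x + t y for all real t. The quadratic polynomial in t is
  evaluated at its minimizer; since the form may be degenerate, the case of a vanishing leading
  coefficient is separate.\<close>

lemma positive_ops_Cauchy_Schwarz:
  assumes A: "A \<in> positive_ops V" and V: "closed_csubspace V" and "x \<in> V" "y \<in> V"
  shows "(inner (A x) y)\<^sup>2 \<le> inner (A x) x * inner (A y) y"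
proof -
  have quad: "0 \<le> inner (A x) x + 2 * t * inner (A x) y + t\<^sup>2 * inner (A y) y" for t :: real
  proof -
    have "x + t *\<^sub>R y \<in> V"
      using assms(3,4) subspace_if_closed_csubspace[OF V] by (simp add: subspace_add subspace_scale)
    then have "0 \<le> inner (A (x + t *\<^sub>R y)) (x + t *\<^sub>R y)"
      by (rule positive_opsD[OF A])
    also have "A (x + t *\<^sub>R y) = A x + t *\<^sub>R A y"
      using bounded_opsD[OF positive_opsD(1)[OF A] V] assms(3,4)
        subspace_scale[OF subspace_if_closed_csubspace[OF V]] by simp
    finally show ?thesis
      using positive_ops_symmetric[OF A V assms(4,3)]
      by (simp add: algebra_simps power2_eq_square inner_commute)
  qed
  show ?thesis
  proof (cases "inner (A y) y = 0")
    case True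
    have "inner (A x) y = 0"
    proof (rule ccontr)
      assume nz: "inner (A x) y \<noteq> 0"
      show False
        \<comment> \<open>The polynomial is affine in t now, and this t gives it the value
          -1.\<close>
        using quad[of "- (inner (A x) x + 1) / (2 * inner (A x) y)"] True nz
        by (simp add: field_simps)
    qed
    with True show ?thesis by simp
  next
    case False
    then have "inner (A y) y > 0"
      using positive_opsD(2)[OF A \<open>y \<in> V\<close>] by simp
    then show ?thesis
      using quad[of "- inner (A x) y / inner (A y) y"]
      by (simp add: field_simps power2_eq_square)
  qed
qed

text \<open>Polarization: by symmetry, the forms at x + y, x and y determine
  \<open>inner (A x) y\<close>. This is the uniqueness behind the description of
  \<open>parallel_sum\<close>.\<close>

lemma positive_ops_eqI:
  assumes "A \<in> positive_ops UNIV" "C \<in> positive_ops UNIV"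
    and "\<And>x. cinner (A x) x = cinner (C x) x"
  shows "A = C"
proof
  fix x
  note A = positive_opsD(1)[OF assms(1)] and C = positive_opsD(1)[OF assms(2)]
  have form: "inner (A z) z = inner (C z) z" for z
    using assms(3) by (simp add: inner_eq_Re_cinner)
  have "inner (A x) y = inner (C x) y" for y
    using form[of "x + y"] form[of x] form[of y]
      positive_ops_symmetric[OF assms(1), of y x] positive_ops_symmetric[OF assms(2), of y x]
    by (simp add: bounded_opsD[OF A] bounded_opsD[OF C] inner_add_left inner_add_right inner_commute)
  from this[of "A x - C x"] have "inner (A x - C x) (A x - C x) = 0"
    by (simp add: inner_diff_left)
  then show "A x = C x" by simp
qed



section \<open>Representation on the closure of a range\<close>

text \<open>The vector is the limit of a minimizing sequence of \<open>\<parallel>j x\<parallel>\<^sup>2 - 2 \<phi> x\<close>. The functional is only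
  given on the parameter space, so that no extension to the closure is needed.\<close>

lemma riesz_closure_range:
  fixes j :: "'h::real_vector \<Rightarrow> 'k::{real_inner, complete_space}" and \<phi> :: "'h \<Rightarrow> real"
  assumes j: "linear j" and \<phi>: "linear \<phi>" and bound: "\<And>x. \<bar>\<phi> x\<bar> \<le> C * norm (j x)"
  shows "\<exists>k\<in>closure (range j). \<forall>x. inner k (j x) = \<phi> x"
proof -
  define E where "E x = (norm (j x))\<^sup>2 - 2 * \<phi> x" for x
  define d where "d = (INF x. E x)"
  \<comment> \<open>Completing the square: \<open>E x\<close> is at least
    \<open>(norm (j x) - C)\<^sup>2 - C\<^sup>2\<close>.\<close>
  have E_ge: "- C\<^sup>2 \<le> E x" for x
  proof -
    have "0 \<le> (norm (j x) - C)\<^sup>2" by simp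
    then show ?thesis
      using bound[of x] by (simp add: E_def power2_eq_square algebra_simps)
  qed
  then have bdd: "bdd_below (range E)" by (meson bdd_belowI2)
  then have d_le: "d \<le> E x" for x by (simp add: d_def cINF_lower)
  have "\<exists>x. E x < d + 1 / real (Suc n)" for n
    using cINF_less_iff[OF _ bdd, of "d + 1 / real (Suc n)"] by (auto simp: d_def)
  then obtain X where X: "\<And>n. E (X n) < d + 1 / real (Suc n)" by metis
  \<comment> \<open>The parallelogram law says that the left side equals 2 E x + 2 E y minus four
    times \<open>E\<close> at the midpoint, where \<open>E\<close> is at least
    \<open>d\<close>.\<close>
  have parallelogram: "(norm (j x - j y))\<^sup>2 \<le> 2 * (E x - d) + 2 * (E y - d)" for x y
  proof -
    have "j ((1 / 2) *\<^sub>R (x + y)) = (1 / 2) *\<^sub>R (j x + j y)"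
      by (simp only: linear_add[OF j] linear_scale[OF j])
    moreover have "\<phi> ((1 / 2) *\<^sub>R (x + y)) = (\<phi> x + \<phi> y) / 2"
      by (simp add: linear_add[OF \<phi>] linear_scale[OF \<phi>] add_divide_distrib)
    ultimately have "E ((1 / 2) *\<^sub>R (x + y)) = inner (j x + j y) (j x + j y) / 4 - \<phi> x - \<phi> y"
      by (simp only: E_def norm_scaleR power_mult_distrib power2_norm_eq_inner)
        (simp add: power2_eq_square field_simps)
    moreover have "inner (j x + j y) (j x + j y) =
        inner (j x) (j x) + 2 * inner (j x) (j y) + inner (j y) (j y)"
      "(norm (j x - j y))\<^sup>2 = inner (j x) (j x) - 2 * inner (j x) (j y) + inner (j y) (j y)"
      "E x = inner (j x) (j x) - 2 * \<phi> x" "E y = inner (j y) (j y) - 2 * \<phi> y"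
      by (simp_all add: E_def power2_norm_eq_inner inner_add_left inner_add_right inner_diff_left
          inner_diff_right inner_commute)
    moreover have "4 * d \<le> 4 * E ((1 / 2) *\<^sub>R (x + y))" by (simp add: d_le)
    ultimately show ?thesis by argo
  qed
  have "Cauchy (\<lambda>n. j (X n))"
  proof (rule CauchyI)
    fix e :: real assume "e > 0"
    \<comment> \<open>\<open>parallelogram\<close> doubles each of two gaps, so gaps below
      \<open>e\<^sup>2 / 4\<close> bound the squared distance by \<open>e\<^sup>2\<close>.\<close>
    then obtain N where N: "1 / real (Suc N) < e\<^sup>2 / 4"
      using reals_Archimedean[of "e\<^sup>2 / 4"] by (auto simp: inverse_eq_divide)
    have "norm (j (X m) - j (X n)) < e" if "m \<ge> N" "n \<ge> N" for m n
    proof -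
      have small: "E (X p) - d < e\<^sup>2 / 4" if "p \<ge> N" for p
      proof -
        have "1 / real (Suc p) \<le> 1 / real (Suc N)" using that by (intro divide_left_mono) auto
        with X[of p] N show ?thesis by linarith
      qed
      have "(norm (j (X m) - j (X n)))\<^sup>2 < e\<^sup>2"
        using parallelogram[of "X m" "X n"] small[OF that(1)] small[OF that(2)]
        by argo
      then show ?thesis using \<open>e > 0\<close> by (simp add: power_less_imp_less_base)
    qed
    then show "\<exists>M. \<forall>m\<ge>M. \<forall>n\<ge>M. norm (j (X m) - j (X n)) < e" by blast
  qed
  then obtain k where k: "(\<lambda>n. j (X n)) \<longlonglongrightarrow> k"
    using Cauchy_convergent convergent_def by blast
  have "inner k (j x) = \<phi> x" for x
  proof -
    define a where "a = inner k (j x) - \<phi> x"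
    define q where "q = (norm (j x))\<^sup>2"
    \<comment> \<open>Moving \<open>X n\<close> by t x lowers \<open>E\<close> by less than 1 / (n +
      1), because \<open>E\<close> stays above \<open>d\<close>. In the limit this is the optimality
      condition at \<open>k\<close>.\<close>
    have quad: "0 \<le> 2 * t * a + t\<^sup>2 * q" for t :: real
    proof (rule LIMSEQ_le_const)
      have "(\<lambda>n. 1 / real (Suc n)) \<longlonglongrightarrow> 0"
        using LIMSEQ_inverse_real_of_nat by (simp add: inverse_eq_divide)
      then have "(\<lambda>n. 1 / real (Suc n) + 2 * t * (inner (j (X n)) (j x) - \<phi> x) + t\<^sup>2 * q)
          \<longlonglongrightarrow> 0 + 2 * t * (inner k (j x) - \<phi> x) + t\<^sup>2 * q"
        by (intro tendsto_intros k)
      then show "(\<lambda>n. 1 / real (Suc n) + 2 * t * (inner (j (X n)) (j x) - \<phi> x) + t\<^sup>2 * q)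
          \<longlonglongrightarrow> 2 * t * a + t\<^sup>2 * q" by (simp add: a_def)
      have "0 \<le> 1 / real (Suc n) + 2 * t * (inner (j (X n)) (j x) - \<phi> x) + t\<^sup>2 * q" for n
      proof -
        have "E (X n + t *\<^sub>R x) = E (X n) + 2 * t * (inner (j (X n)) (j x) - \<phi> x) + t\<^sup>2 * q"
        proof -
          have "(norm (j (X n) + t *\<^sub>R j x))\<^sup>2 =
              (norm (j (X n)))\<^sup>2 + 2 * t * inner (j (X n)) (j x) + t\<^sup>2 * (norm (j x))\<^sup>2"
            unfolding power2_norm_eq_inner
            by (simp add: inner_add_left inner_add_right inner_commute power2_eq_square)
          then show ?thesis
            by (simp add: E_def q_def linear_add[OF j] linear_scale[OF j] linear_add[OF \<phi>]
                linear_scale[OF \<phi>] algebra_simps)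
        qed
        then show ?thesis using d_le[of "X n + t *\<^sub>R x"] X[of n] by linarith
      qed
      then show "\<exists>N. \<forall>n\<ge>N.
          0 \<le> 1 / real (Suc n) + 2 * t * (inner (j (X n)) (j x) - \<phi> x) + t\<^sup>2 * q" by blast
    qed
    have "q \<ge> 0" by (simp add: q_def)
    \<comment> \<open>The minimizer would be - a / q, but \<open>q\<close> may be 0; with q + 1 in
      the denominator the value is still negative unless \<open>a\<close> = 0.\<close>
    then have "2 * (- a / (q + 1)) * a + (- a / (q + 1))\<^sup>2 * q = - (a\<^sup>2 * (q + 2)) / (q + 1)\<^sup>2"
      by (simp add: divide_simps) (simp add: power2_eq_square algebra_simps)
    with quad[of "- a / (q + 1)"] have "a\<^sup>2 * (q + 2) / (q + 1)\<^sup>2 \<le> 0" by simp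
    with \<open>q \<ge> 0\<close> have "a\<^sup>2 * (q + 2) \<le> 0"
      by (simp add: divide_le_0_iff)
    with \<open>q \<ge> 0\<close> have "a\<^sup>2 \<le> 0" by (simp add: mult_le_0_iff)
    then show ?thesis by (simp add: a_def)
  qed
  moreover have "k \<in> closure (range j)"
    using k unfolding closure_sequential
    by (intro exI[of _ "\<lambda>n. j (X n)"] conjI allI rangeI)
  ultimately show ?thesis by blast
qed

text \<open>The bound is a closed condition on the vector in the second slot, so it extends from the
  range to its closure and may be used at \<open>k\<close> itself.\<close>

lemma norm_le_if_inner_le_on_range:
  fixes k :: "'k::real_inner"
  assumes "k \<in> closure (range j)" "\<And>x. inner k (j x) \<le> C * norm (j x)" "C \<ge> 0"
  shows "norm k \<le> C"
proof -
  have "closed {z. inner k z \<le> C * norm z}"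
    by (intro closed_Collect_le continuous_intros)
  then have "closure (range j) \<subseteq> {z. inner k z \<le> C * norm z}"
    using assms(2) by (intro closure_minimal) auto
  with assms(1) have "norm k * norm k \<le> C * norm k"
    by (auto simp: power2_norm_eq_inner[symmetric] power2_eq_square)
  with assms(3) show ?thesis
    by (cases "k = 0") auto
qed

lemma tendsto_scaleC:
  assumes "X \<longlonglongrightarrow> (x::'a::chilbert_space)"
  shows "(\<lambda>n. c *\<^sub>C X n) \<longlonglongrightarrow> c *\<^sub>C x"
proof (rule bounded_ops_tendsto[of "\<lambda>x. c *\<^sub>C x" UNIV UNIV])
  show "(\<lambda>x::'a. c *\<^sub>C x) \<in> bounded_ops UNIV UNIV"
    by (rule bounded_opsI[of _ _ _ "cmod c"])
      (simp_all add: scaleC_add_right norm_scaleC scaleC_left_commute)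
qed (simp_all add: assms)

lemma tendsto_cinner:
  assumes "X \<longlonglongrightarrow> (x::'a::chilbert_space)" "Y \<longlonglongrightarrow> y"
  shows "(\<lambda>n. cinner (X n) (Y n)) \<longlonglongrightarrow> cinner x y"
  unfolding cinner_eq_Complex by (intro tendsto_Complex tendsto_inner tendsto_scaleC assms)

lemma closed_csubspace_closure_range:
  assumes "clinear_on UNIV j"
  shows "closed_csubspace (closure (range j))"
  unfolding closed_csubspace_def
proof (intro conjI ballI allI)
  note j = clinear_onD[OF assms UNIV_I]
  have "j 0 = 0" using j(1)[OF UNIV_I, of 0 0] by simp
  then show "0 \<in> closure (range j)" using closure_subset[of "range j"] by (metis rangeI subsetD)
  show "x + y \<in> closure (range j)" if xy: "x \<in> closure (range j)" "y \<in> closure (range j)" for x y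
  proof -
    obtain X Y where "\<And>n. X n \<in> range j" "X \<longlonglongrightarrow> x" "\<And>n. Y n \<in> range j" "Y \<longlonglongrightarrow> y"
      using xy unfolding closure_sequential by blast
    moreover have "a + b \<in> range j" if "a \<in> range j" "b \<in> range j" for a b
      using that by (auto simp: j(1)[OF UNIV_I, symmetric])
    ultimately have "(\<lambda>n. X n + Y n) \<longlonglongrightarrow> x + y" "\<And>n. X n + Y n \<in> range j"
      by (simp_all add: tendsto_add)
    then show ?thesis
      unfolding closure_sequential by (intro exI[of _ "\<lambda>n. X n + Y n"] conjI allI)
  qed
  show "c *\<^sub>C x \<in> closure (range j)" if x: "x \<in> closure (range j)" for c x
  proof -
    obtain X where X: "\<And>n. X n \<in> range j" "X \<longlonglongrightarrow> x"
      using x unfolding closure_sequential by blast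
    have "(\<lambda>n. c *\<^sub>C X n) \<longlonglongrightarrow> c *\<^sub>C x"
      by (rule tendsto_scaleC[OF X(2)])
    moreover have "c *\<^sub>C X n \<in> range j" for n
      using X(1)[of n] by (auto simp: j(2)[symmetric])
    ultimately show ?thesis
      unfolding closure_sequential by (intro exI[of _ "\<lambda>n. c *\<^sub>C X n"] conjI allI)
  qed
qed simp

text \<open>The difference \<open>k - l\<close> lies in the closure and is orthogonal to the range,
  so the preceding estimate applies to it with the constant 0.\<close>

lemma eq_if_inner_eq_on_range:
  assumes "clinear_on UNIV j" "k \<in> closure (range j)" "l \<in> closure (range j)"
    and "\<And>x. inner k (j x) = inner l (j x)"
  shows "k = l"
proof -
  have "k - l \<in> closure (range j)"
    using closed_csubspace_closure_range[OF assms(1)] assms(2,3)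
    by (simp add: subspace_if_closed_csubspace subspace_diff)
  then have "norm (k - l) \<le> 0"
    by (rule norm_le_if_inner_le_on_range) (simp_all add: inner_diff_left assms(4))
  then show ?thesis by simp
qed

text \<open>Douglas' lemma: \<open>G\<close> is the adjoint of the bounded extension of \<open>j x \<mapsto> F x\<close>.\<close>

lemma douglas:
  fixes j :: "'h::chilbert_space \<Rightarrow> 'k::chilbert_space" and F :: "'h \<Rightarrow> 'g::chilbert_space"
  assumes j: "clinear_on UNIV j" and F: "clinear_on UNIV F"
    and bound: "C \<ge> 0" "\<And>x. norm (F x) \<le> C * norm (j x)"
  obtains G where "G \<in> bounded_ops UNIV (closure (range j))"
    and "\<And>u x. cinner (G u) (j x) = cinner u (F x)"
    and "\<And>u. norm (G u) \<le> C * norm u"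
proof -
  note lj = linear_if_clinear[OF j] and lF = linear_if_clinear[OF F]
  have "\<exists>k\<in>closure (range j). \<forall>x. inner k (j x) = inner u (F x)" for u
  proof (rule riesz_closure_range[OF lj])
    show "linear (\<lambda>x. inner u (F x))"
      by (auto intro!: linearI simp: linear_add[OF lF] linear_scale[OF lF] inner_add_right)
    show "\<bar>inner u (F x)\<bar> \<le> norm u * C * norm (j x)" for x
    proof -
      have "norm u * norm (F x) \<le> norm u * (C * norm (j x))"
        by (rule mult_left_mono[OF bound(2)]) simp
      then show ?thesis using Cauchy_Schwarz_ineq2[of u "F x"] by (simp add: mult.assoc)
    qed
  qed
  then obtain G where G: "\<And>u. G u \<in> closure (range j)" "\<And>u x. inner (G u) (j x) = inner u (F x)"
    by metis
  note V = closed_csubspace_closure_range[OF j]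
  have norm_G: "norm (G u) \<le> C * norm u" for u
  proof (rule norm_le_if_inner_le_on_range[OF G(1)])
    show "inner (G u) (j x) \<le> C * norm u * norm (j x)" for x
    proof -
      have "norm u * norm (F x) \<le> norm u * (C * norm (j x))"
        by (rule mult_left_mono[OF bound(2)]) simp
      then show ?thesis using norm_cauchy_schwarz[of u "F x"]
        by (simp add: G(2) mult.left_commute mult.commute)
    qed
  qed (simp add: bound)
  have V': "x \<in> closure (range j) \<Longrightarrow> y \<in> closure (range j) \<Longrightarrow> x + y \<in> closure (range j)"
    "x \<in> closure (range j) \<Longrightarrow> c *\<^sub>C x \<in> closure (range j)" for x y c
    using V by (auto simp: closed_csubspace_def)
  have "G \<in> bounded_ops UNIV (closure (range j))"
  proof (rule bounded_opsI[of _ _ _ C])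
    show "G (u + v) = G u + G v" for u v
      by (rule eq_if_inner_eq_on_range[OF j]) (simp_all add: G V' inner_add_left)
    show "G (c *\<^sub>C u) = c *\<^sub>C G u" for c u
    proof (rule eq_if_inner_eq_on_range[OF j])
      show "inner (G (c *\<^sub>C u)) (j x) = inner (c *\<^sub>C G u) (j x)" for x
        by (simp add: G inner_scaleC_left clinear_onD(2)[OF j, symmetric] clinear_onD(2)[OF F])
    qed (use G V' in auto)
  qed (use G norm_G in auto)
  moreover have "cinner (G u) (j x) = cinner u (F x)" for u x
    by (simp add: cinner_eq_Complex G(2) clinear_onD(2)[OF j, symmetric]
        clinear_onD(2)[OF F, symmetric])
  ultimately show ?thesis using that norm_G by blast
qed

lemma bounded_ops_eq_on_range:
  assumes "clinear_on UNIV j" "S \<in> bounded_ops (closure (range j)) W"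
    and "T \<in> bounded_ops (closure (range j)) W'" "\<And>x. S (j x) = T (j x)"
  shows "S = T"
proof (rule bounded_ops_eqI[OF assms(2,3)])
  fix u assume u: "u \<in> closure (range j)"
  then obtain X where X: "\<And>n. X n \<in> range j" "X \<longlonglongrightarrow> u"
    unfolding closure_sequential by blast
  note V = closed_csubspace_closure_range[OF assms(1)]
  have X': "X n \<in> closure (range j)" for n
    by (rule subsetD[OF closure_subset X(1)])
  have "S (X n) = T (X n)" for n
    using X(1)[of n] assms(4) by auto
  then have "(\<lambda>n. T (X n)) \<longlonglongrightarrow> S u"
    using bounded_ops_tendsto[OF assms(2) V X' u X(2)] by simp
  then show "S u = T u"
    by (rule LIMSEQ_unique) (rule bounded_ops_tendsto[OF assms(3) V X' u X(2)])
qed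

section \<open>Orthogonal projections onto closures of ranges\<close>

text \<open>Douglas' lemma with both maps equal to \<open>j\<close> and constant 1 yields the
  adjoint of the inclusion of the closure of the range, which is the projection onto it.\<close>

lemma orth_projection_closure_range:
  fixes j :: "'h::chilbert_space \<Rightarrow> 'k::chilbert_space"
  assumes j: "clinear_on UNIV j"
  obtains P where "P \<in> bounded_ops UNIV (closure (range j))" "P \<in> orth_projections UNIV"
    and "\<And>u x. inner (P u) (j x) = inner u (j x)"
proof -
  obtain P where P: "P \<in> bounded_ops UNIV (closure (range j))"
    and cP: "\<And>u x. cinner (P u) (j x) = cinner u (j x)"
    by (rule douglas[OF j j, of 1]) (simp, simp, rule that)
  note D = bounded_opsD[OF P closed_csubspace_UNIV]
  have iP: "inner (P u) (j x) = inner u (j x)" for u x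
    using cP by (simp add: inner_eq_Re_cinner)
  have P': "P \<in> bounded_ops UNIV UNIV"
    using P by (auto simp: bounded_ops_def)
  have idem: "P (P u) = P u" for u
    by (rule eq_if_inner_eq_on_range[OF j]) (simp_all add: D(1) iP)
  have inner_P: "inner (P u) w = inner u w" if "w \<in> closure (range j)" for u w
  proof -
    have "closed {w. inner (P u) w = inner u w}"
      by (intro closed_Collect_eq continuous_intros)
    then have "closure (range j) \<subseteq> {w. inner (P u) w = inner u w}"
      by (intro closure_minimal) (auto simp: iP)
    then show ?thesis using that by blast
  qed
  have sym: "inner (P u) v = inner u (P v)" for u v
    using inner_P[of "P u" v] inner_P[of "P v" u] D(1) by (simp add: inner_commute)
  have "cinner (P u) v = cinner u (P v)" for u v
    by (simp add: cinner_eq_Complex sym D(4))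
  then have "P \<in> orth_projections UNIV"
    using P' idem by (simp add: orth_projections_def)
  then show ?thesis by (rule that[OF P _ iP])
qed

lemma orth_projections_positive:
  assumes "P \<in> orth_projections V" "closed_csubspace V"
  shows "P \<in> positive_ops V"
proof -
  have P: "P \<in> bounded_ops V V" "\<And>x. x \<in> V \<Longrightarrow> P (P x) = P x"
    "\<And>x y. x \<in> V \<Longrightarrow> y \<in> V \<Longrightarrow> cinner (P x) y = cinner x (P y)"
    using assms(1) by (auto simp: orth_projections_def)
  have "cinner (P x) x = complex_of_real ((norm (P x))\<^sup>2)" if "x \<in> V" for x
    using P(2)[OF that] P(3)[of "P x" x] that bounded_opsD(1)[OF P(1) assms(2)]
    by (simp only: cinner_self)
  then show ?thesis
    using P(1) by (simp add: positive_ops_def)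
qed

lemma positive_ops_scaled:
  assumes "A \<in> positive_ops V" "closed_csubspace V"
  shows "(\<lambda>x\<in>V. of_nat n *\<^sub>C A x) \<in> positive_ops V"
  using assms bounded_ops_scaled[OF positive_opsD(1)[OF assms(1)] assms(2,2), of "of_nat n"]
  by (auto simp: positive_ops_def cinner_scaleC_left in_Reals_nonneg_iff)

section \<open>The correspondence between operators on the auxiliary space and on H\<close>

locale aux_completion =
  fixes B :: "'a::chilbert_space \<Rightarrow> 'a"
    and K :: "'k::chilbert_space set"
    and \<iota> :: "'a \<Rightarrow> 'k"
  assumes B: "B \<in> positive_ops UNIV" and aux: "aux_space B K \<iota>"
begin

definition j :: "'a \<Rightarrow> 'k" where "j x = \<iota> (B x)"

abbreviation J :: "'k \<Rightarrow> 'a" where "J \<equiv> J_op B K \<iota>"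

lemmas B_bounded = positive_opsD(1)[OF B]

lemma csubspace_K: "closed_csubspace K"
  using aux by (simp add: aux_space_def)

lemma clinear_j: "clinear_on UNIV j"
proof -
  have "clinear_on (range B) \<iota>" using aux by (simp add: aux_space_def)
  then show ?thesis
    by (auto simp: clinear_on_def j_def bounded_opsD[OF B_bounded])
qed

lemma cinner_j: "cinner (j x) (j y) = cinner (B x) y"
  using aux by (simp add: aux_space_def j_def)

lemma inner_j: "inner (j x) (j y) = inner (B x) y"
  by (simp add: inner_eq_Re_cinner cinner_j)

lemma closure_range_j: "closure (range j) = K"
proof -
  have "range j = \<iota> ` range B" by (auto simp: j_def)
  then show ?thesis using aux by (simp add: aux_space_def)
qed

lemma j_in_K [simp]: "j x \<in> K"
  using closure_subset[of "range j"] by (auto simp: closure_range_j)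

lemma add_in_K: "u \<in> K \<Longrightarrow> v \<in> K \<Longrightarrow> u + v \<in> K"
  and diff_in_K: "u \<in> K \<Longrightarrow> v \<in> K \<Longrightarrow> u - v \<in> K"
  and scaleC_in_K: "u \<in> K \<Longrightarrow> c *\<^sub>C u \<in> K"
  using csubspace_K subspace_if_closed_csubspace[OF csubspace_K]
  by (auto simp: closed_csubspace_def subspace_diff)

lemmas j_add = clinear_onD(1)[OF clinear_j UNIV_I UNIV_I]
  and j_scaleC = clinear_onD(2)[OF clinear_j UNIV_I]
  and j_diff = linear_diff[OF linear_if_clinear[OF clinear_j]]

text \<open>The squared norm of \<open>j x\<close> is (B x | x), at most M times the squared norm of
  x for a norm bound M of \<open>B\<close>; hence the constant \<open>sqrt M\<close>.\<close>

lemma j_bound: obtains C where "C \<ge> 0" "\<And>x. norm (j x) \<le> C * norm x"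
proof -
  obtain M where M: "M \<ge> 0" "\<And>x. x \<in> UNIV \<Longrightarrow> norm (B x) \<le> M * norm x"
    by (rule bounded_ops_bound[OF B_bounded]) (rule that)
  have "norm (j x) \<le> sqrt M * norm x" for x
  proof -
    have "(norm (j x))\<^sup>2 \<le> norm (B x) * norm x"
      by (simp add: power2_norm_eq_inner inner_j norm_cauchy_schwarz)
    also have "\<dots> \<le> (M * norm x) * norm x"
      by (rule mult_right_mono[OF M(2)]) simp_all
    also have "\<dots> = (sqrt M * norm x)\<^sup>2"
      using M(1) by (simp add: power_mult_distrib power2_eq_square)
    finally show ?thesis by (rule power2_le_imp_le) (simp add: M(1))
  qed
  then show ?thesis using that[of "sqrt M"] M(1) by simp
qed

lemma j_bounded: "j \<in> bounded_ops UNIV K"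
proof -
  obtain C where "\<And>x. norm (j x) \<le> C * norm x" by (rule j_bound) (rule that)
  then show ?thesis by (intro bounded_opsI[of _ _ _ C]) (simp_all add: j_add j_scaleC)
qed

lemma eq_in_K:
  assumes "u \<in> K" "v \<in> K" "\<And>x. inner u (j x) = inner v (j x)"
  shows "u = v"
  using eq_if_inner_eq_on_range[OF clinear_j] assms by (simp add: closure_range_j)

lemma eq_if_eq_on_j:
  assumes "S \<in> bounded_ops K W" "T \<in> bounded_ops K W'" "\<And>x. S (j x) = T (j x)"
  shows "S = T"
  by (rule bounded_ops_eq_on_range[OF clinear_j, unfolded closure_range_j, OF assms])

section \<open>The operator \<open>J\<close> and its adjoint\<close>

text \<open>Douglas' lemma is used with the identity of H as the dominating map and \<open>j\<close>
  as the dominated one, so that \<open>G\<close> is the adjoint of \<open>j\<close>. On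
  \<open>j x\<close> it has the value \<open>B x\<close>, since both have the same inner products
  with all y; density of \<open>range j\<close> gives the uniqueness required by
  \<open>THE\<close>.\<close>

lemma
  shows J_bounded: "J \<in> bounded_ops K UNIV"
    and J_j: "J (j x) = B x"
    and cinner_J: "u \<in> K \<Longrightarrow> cinner (J u) x = cinner u (j x)"
proof -
  obtain C where C: "C \<ge> 0" "\<And>x. norm (j x) \<le> C * norm x" by (rule j_bound) (rule that)
  obtain G :: "'k \<Rightarrow> 'a" where G: "G \<in> bounded_ops UNIV (closure (range (\<lambda>x. x)))"
    and cG: "\<And>u x. cinner (G u) x = cinner u (j x)"
  proof (rule douglas[OF _ clinear_j C])
    show "clinear_on UNIV (\<lambda>x::'a. x)" by (simp add: clinear_on_def)
  qed (rule that)
  have G': "restrict G K \<in> bounded_ops K UNIV"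
    using G by (intro bounded_ops_restrict csubspace_K) auto
  have Gj: "restrict G K (j x) = B x" for x
  proof -
    have "inner (G (j x)) y = inner (B x) y" for y
      by (simp add: inner_eq_Re_cinner cG cinner_j)
    from this[of "G (j x) - B x"] have "inner (G (j x) - B x) (G (j x) - B x) = 0"
      by (simp add: inner_diff_left)
    then show ?thesis by simp
  qed
  have J: "J = restrict G K"
    unfolding J_op_def
  proof (rule the_equality)
    show "J' = restrict G K"
      if "J' \<in> bounded_ops K UNIV \<and> (\<forall>x. J' (\<iota> (B x)) = B x)" for J'
      using that Gj by (intro eq_if_eq_on_j[of J' UNIV _ UNIV] G') (auto simp: j_def)
  qed (use G' Gj in \<open>auto simp: j_def\<close>)
  show "J \<in> bounded_ops K UNIV" "J (j x) = B x" using G' Gj by (simp_all add: J)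
  show "cinner (J u) x = cinner u (j x)" if "u \<in> K" using that cG by (simp add: J)
qed

lemma adjoint_J: "adjoint_op K UNIV J = j"
  unfolding adjoint_op_def
proof (rule the_equality)
  show "j \<in> bounded_ops UNIV K \<and> (\<forall>x\<in>K. \<forall>y\<in>UNIV. cinner (J x) y = cinner x (j y))"
    by (simp add: j_bounded cinner_J)
next
  fix S assume S: "S \<in> bounded_ops UNIV K \<and> (\<forall>x\<in>K. \<forall>y\<in>UNIV. cinner (J x) y = cinner x (S y))"
  show "S = j"
  proof
    fix y
    have "cinner (j x) (S y) = cinner (j x) (j y)" for x
      using S by (metis UNIV_I cinner_J j_in_K)
    then have "inner (j x) (S y) = inner (j x) (j y)" for x
      by (simp only: inner_eq_Re_cinner)
    then have "inner (S y) (j x) = inner (j y) (j x)" for x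
      by (metis inner_commute)
    then show "S y = j y"
      using S bounded_opsD(1)[OF _ closed_csubspace_UNIV] by (intro eq_in_K) auto
  qed
qed

section \<open>The map \<open>T \<mapsto> J T J\<^sup>*\<close>: positivity, injectivity and
  order\<close>

abbreviation \<Psi> :: "('k \<Rightarrow> 'k) \<Rightarrow> 'a \<Rightarrow> 'a" where "\<Psi> \<equiv> Psi B K \<iota>"

lemma Psi_apply: "\<Psi> T x = J (T (j x))"
  by (simp add: Psi_def adjoint_J)

lemma cinner_Psi:
  "T \<in> bounded_ops K K \<Longrightarrow> cinner (\<Psi> T x) y = cinner (T (j x)) (j y)"
  by (simp add: Psi_apply cinner_J bounded_opsD(1)[OF _ csubspace_K])

lemma Psi_bounded:
  assumes T: "T \<in> bounded_ops K K"
  shows "\<Psi> T \<in> bounded_ops UNIV UNIV"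
proof -
  obtain N where N: "N \<ge> 0" "\<And>x. x \<in> K \<Longrightarrow> norm (J x) \<le> N * norm x"
    by (rule bounded_ops_bound[OF J_bounded]) (rule that)
  obtain M where M: "M \<ge> 0" "\<And>x. x \<in> K \<Longrightarrow> norm (T x) \<le> M * norm x"
    by (rule bounded_ops_bound[OF T]) (rule that)
  obtain C where C: "\<And>x. norm (j x) \<le> C * norm x" by (rule j_bound) (rule that)
  note D = bounded_opsD[OF T csubspace_K] bounded_opsD(2-)[OF J_bounded csubspace_K]
  have "norm (\<Psi> T x) \<le> N * (M * C) * norm x" for x
  proof -
    have "norm (J (T (j x))) \<le> N * norm (T (j x))" by (simp add: N(2) D(1))
    also have "norm (T (j x)) \<le> M * norm (j x)" by (simp add: M(2))
    also have "norm (j x) \<le> C * norm x" by (rule C)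
    finally show ?thesis using N(1) M(1) by (simp add: Psi_apply mult_left_mono mult.assoc)
  qed
  then show ?thesis
    by (intro bounded_opsI[of _ _ _ "N * (M * C)"]) (simp_all add: Psi_apply j_add j_scaleC D)
qed

text \<open>The form of \<open>\<Psi> T\<close> at x is that of \<open>T\<close> at
  \<open>j x\<close>. Every vector of \<open>K\<close> is a limit of vectors \<open>j x\<close>, and
  the nonnegative reals are closed, so positivity on \<open>range j\<close> extends to
  \<open>K\<close>.\<close>

lemma Psi_positive_iff:
  assumes T: "T \<in> bounded_ops K K"
  shows "\<Psi> T \<in> positive_ops UNIV \<longleftrightarrow> T \<in> positive_ops K"
proof
  assume pos: "\<Psi> T \<in> positive_ops UNIV"
  have "cinner (T u) u \<in> \<real>\<^sub>\<ge>\<^sub>0" if u: "u \<in> K" for u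
  proof -
    obtain X where X: "\<And>n. X n \<in> range j" and lim: "X \<longlonglongrightarrow> u"
      using u unfolding closure_range_j[symmetric] closure_sequential by blast
    have XK: "X n \<in> K" for n
      using X[of n] by auto
    have "cinner (T (j x)) (j x) \<in> \<real>\<^sub>\<ge>\<^sub>0" for x
      using pos by (simp add: positive_ops_def cinner_Psi[OF T])
    then have nonneg: "cinner (T (X n)) (X n) \<in> \<real>\<^sub>\<ge>\<^sub>0" for n
      using X[of n] by (metis imageE)
    show ?thesis
      by (rule closed_sequentially[OF closed_nonneg_Reals_complex nonneg
            tendsto_cinner[OF bounded_ops_tendsto[OF T csubspace_K XK u lim] lim]])
  qed
  then show "T \<in> positive_ops K"
    using T by (simp add: positive_ops_def)
next
  assume "T \<in> positive_ops K"
  then show "\<Psi> T \<in> positive_ops UNIV"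
    using Psi_bounded[OF T] by (simp add: positive_ops_def cinner_Psi[OF T])
qed

lemma Psi_inj:
  assumes "S \<in> bounded_ops K K" "T \<in> bounded_ops K K" "\<Psi> S = \<Psi> T"
  shows "S = T"
proof (rule eq_if_eq_on_j[OF assms(1,2)])
  fix x
  show "S (j x) = T (j x)"
  proof (rule eq_in_K)
    show "S (j x) \<in> K" "T (j x) \<in> K"
      by (simp_all add: bounded_opsD(1)[OF assms(1) csubspace_K]
          bounded_opsD(1)[OF assms(2) csubspace_K])
    show "inner (S (j x)) (j y) = inner (T (j x)) (j y)" for y
      by (simp only: inner_eq_Re_cinner assms(3)
          flip: cinner_Psi[OF assms(1)] cinner_Psi[OF assms(2)])
  qed
qed

lemma Psi_diff:
  assumes "S \<in> bounded_ops K K" "T \<in> bounded_ops K K"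
  shows "\<Psi> (\<lambda>u\<in>K. S u - T u) x = \<Psi> S x - \<Psi> T x"
  by (simp add: Psi_apply bounded_opsD(3)[OF J_bounded csubspace_K]
      bounded_opsD(1)[OF assms(1) csubspace_K] bounded_opsD(1)[OF assms(2) csubspace_K])

lemma Psi_scaled:
  assumes "T \<in> bounded_ops K K"
  shows "\<Psi> (\<lambda>u\<in>K. c *\<^sub>C T u) x = c *\<^sub>C \<Psi> T x"
  by (simp add: Psi_apply bounded_opsD(4)[OF J_bounded csubspace_K]
      bounded_opsD(1)[OF assms csubspace_K])

lemma id_bounded: "(\<lambda>u\<in>K. u) \<in> bounded_ops K K"
  by (intro bounded_opsI[of _ _ _ 1]) (simp_all add: add_in_K scaleC_in_K)

lemma Psi_id: "\<Psi> (\<lambda>u\<in>K. u) = B"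
  by (rule ext) (simp add: Psi_apply J_j)

text \<open>\<open>\<Psi>\<close> respects differences, so this is \<open>Psi_positive_iff\<close>
  for T - S. With the identity in place of \<open>T\<close> it compares \<open>\<Psi> S\<close> with
  \<open>B\<close>.\<close>

lemma op_le_Psi_iff:
  assumes "S \<in> bounded_ops K K" "T \<in> bounded_ops K K"
  shows "op_le UNIV (\<Psi> S) (\<Psi> T) \<longleftrightarrow> op_le K S T"
proof -
  have "\<Psi> (\<lambda>u\<in>K. T u - S u) = (\<lambda>x\<in>UNIV. \<Psi> T x - \<Psi> S x)"
    by (rule ext) (simp add: Psi_diff[OF assms(2,1)])
  then show ?thesis
    using Psi_positive_iff[OF bounded_ops_diff[OF assms(2,1) csubspace_K csubspace_K]]
    by (simp only: op_le_def)
qed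

section \<open>Parallel sums and generalized shorts\<close>

text \<open>In the expansion of the squared norm of u + T u the cross term is nonnegative. The
  second bound makes I + T injective; the first says that (I + T) u \<mapsto> T u is a contraction,
  which is what Douglas' lemma needs.\<close>

lemma inner_add_positive_ge:
  assumes "T \<in> positive_ops K" "u \<in> K"
  shows "norm (T u) \<le> norm (u + T u)" "norm u \<le> norm (u + T u)"
proof -
  have "(norm (u + T u))\<^sup>2 = (norm u)\<^sup>2 + 2 * inner (T u) u + (norm (T u))\<^sup>2"
    by (simp add: power2_norm_eq_inner inner_add_left inner_add_right inner_commute)
  then have "(norm (T u))\<^sup>2 \<le> (norm (u + T u))\<^sup>2" "(norm u)\<^sup>2 \<le> (norm (u + T u))\<^sup>2"
    using positive_opsD(2)[OF assms] by simp_all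
  then show "norm (T u) \<le> norm (u + T u)" "norm u \<le> norm (u + T u)"
    by (auto intro: power2_le_imp_le[OF _ norm_ge_zero])
qed

lemma add_positive_inj:
  assumes T: "T \<in> positive_ops K" and "u \<in> K" "v \<in> K" "u + T u = v + T v"
  shows "u = v"
proof -
  have "(u - v) + T (u - v) = 0"
    unfolding bounded_opsD(3)[OF positive_opsD(1)[OF T] csubspace_K assms(2,3)]
    using assms(4) by (simp add: algebra_simps)
  with inner_add_positive_ge(2)[OF T diff_in_K[OF assms(2,3)]] show ?thesis by simp
qed

text \<open>The equation \<open>S + T S = T\<close> characterizes \<open>S = I : T\<close>.\<close>

lemma parallel_sum_id_ex:
  assumes T: "T \<in> positive_ops K"
  obtains S where "S \<in> bounded_ops K K" "\<And>u. u \<in> K \<Longrightarrow> S u + T (S u) = T u"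
    and "\<And>u. u \<in> K \<Longrightarrow> norm (S u) \<le> norm u"
proof -
  note D = bounded_opsD[OF positive_opsD(1)[OF T] csubspace_K]
  \<comment> \<open>\<open>F\<close> is (I + T) j. Douglas' lemma for \<open>F\<close> and T j gives
    a contraction \<open>G\<close> such that (I + T) \<open>G\<close> and \<open>T\<close> have the
    same inner products with every \<open>j x\<close>; \<open>G\<close> plays the role of
    \<open>T\<close> (I + T)^-1.\<close>
  define F where "F x = j x + T (j x)" for x
  have F: "clinear_on UNIV F"
    by (simp add: clinear_on_def F_def j_add j_scaleC D scaleC_add_right)
  have Tj: "clinear_on UNIV (\<lambda>x. T (j x))"
    by (simp add: clinear_on_def j_add j_scaleC D)
  have bound: "norm (T (j x)) \<le> 1 * norm (F x)" for x
    by (simp add: F_def inner_add_positive_ge(1)[OF T])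
  obtain G where G: "G \<in> bounded_ops UNIV (closure (range F))"
    and cG: "\<And>u x. cinner (G u) (F x) = cinner u (T (j x))"
    and norm_G: "\<And>u. norm (G u) \<le> 1 * norm u"
    by (rule douglas[OF F Tj _ bound]) (simp, rule that)
  have "range F \<subseteq> K"
    by (auto simp: F_def add_in_K D(1))
  then have sub: "closure (range F) \<subseteq> K"
    using csubspace_K by (simp add: closure_minimal closed_csubspace_def)
  have GK: "G u \<in> K" for u
    by (rule subsetD[OF sub bounded_opsD(1)[OF G closed_csubspace_UNIV UNIV_I]])
  have "G \<in> bounded_ops UNIV UNIV"
    using G by (simp add: bounded_ops_def)
  then have bounded: "restrict G K \<in> bounded_ops K K"
    by (rule bounded_ops_restrict[OF _ csubspace_K]) (rule GK)
  have eq: "G u + T (G u) = T u" if "u \<in> K" for u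
  proof (rule eq_in_K)
    fix x
    have "inner (T (G u)) (j x) = inner (G u) (T (j x))"
      by (rule positive_ops_symmetric[OF T csubspace_K GK j_in_K])
    then have "inner (G u + T (G u)) (j x) = inner (G u) (F x)"
      by (simp add: F_def inner_add_left inner_add_right)
    also have "\<dots> = inner u (T (j x))"
      by (simp only: inner_eq_Re_cinner cG)
    also have "\<dots> = inner (T u) (j x)"
      by (rule positive_ops_symmetric[OF T csubspace_K \<open>u \<in> K\<close> j_in_K, symmetric])
    finally show "inner (G u + T (G u)) (j x) = inner (T u) (j x)" .
  qed (simp_all add: add_in_K D(1) GK that)
  show ?thesis
  proof (rule that[OF bounded])
    fix u assume "u \<in> K"
    then show "restrict G K u + T (restrict G K u) = T u" using eq[of u] GK[of u] by simp
    show "norm (restrict G K u) \<le> norm u" using norm_G[of u] \<open>u \<in> K\<close> by simp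
  qed
qed

text \<open>Completing the square. For r = u - S u the equation says T r = S u, so r is the
  stationary point of \<open>q u\<close>: at r + h the value is (S u | u) plus the nonnegative form
  \<open>e h\<close>. Thus (S u | u) is the minimum over \<open>K\<close>, and by density also the
  infimum over \<open>range j\<close>, which is the one in the parallel sum.\<close>

lemma parallel_sum_Psi:
  assumes T: "T \<in> positive_ops K" and S: "S \<in> bounded_ops K K"
    and eq: "\<And>u. u \<in> K \<Longrightarrow> S u + T (S u) = T u"
  shows "parallel_sum B (\<Psi> T) = \<Psi> S"
proof -
  note D = bounded_opsD[OF positive_opsD(1)[OF T] csubspace_K]
  have SK: "S u \<in> K" if "u \<in> K" for u by (rule bounded_opsD(1)[OF S csubspace_K that])
  have Tr: "T (u - S u) = S u" if "u \<in> K" for u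
    unfolding D(3)[OF that SK[OF that]] eq[OF that, symmetric] by simp
  \<comment> \<open>By \<open>Tr\<close>, (S u | u) is the squared norm of S u plus the form of
    \<open>T\<close> at u - S u.\<close>
  have "cinner (S u) u \<in> \<real>\<^sub>\<ge>\<^sub>0" if u: "u \<in> K" for u
  proof -
    have r: "u - S u \<in> K" by (rule diff_in_K[OF u SK[OF u]])
    have "cinner (S u) u = cinner (S u) (S u) + cinner (T (u - S u)) (u - S u)"
      by (simp add: Tr[OF u] cinner_diff_right)
    then show ?thesis
      using positive_opsD(2)[OF T r]
      by (simp add: cinner_self positive_opsD(3)[OF T r] in_Reals_nonneg_iff flip: of_real_power)
  qed
  then have "S \<in> positive_ops K" using S by (simp add: positive_ops_def)
  then have pos: "\<Psi> S \<in> positive_ops UNIV" by (simp add: Psi_positive_iff[OF S])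
  define q where "q u k = inner (u - k) (u - k) + inner (T k) k" for u k
  define e where "e h = inner h h + inner (T h) h" for h
  have q_eq: "q u k = inner (S u) u + e (k - (u - S u))" if u: "u \<in> K" and k: "k \<in> K" for u k
  proof -
    define r h where "r = u - S u" and "h = k - r"
    have r: "r \<in> K" and h: "h \<in> K" using u k by (simp_all add: r_def h_def diff_in_K SK)
    have k_eq: "k = r + h" and u_eq: "u = S u + r" by (simp_all add: r_def h_def)
    have "T k = S u + T h"
      unfolding k_eq by (simp only: D(2)[OF r h] Tr[OF u, folded r_def])
    moreover have "inner (T h) r = inner h (S u)"
      using positive_ops_symmetric[OF T csubspace_K h r] Tr[OF u] by (simp add: r_def)
    moreover have "u - k = S u - h"
      using k_eq u_eq by (simp add: algebra_simps)
    ultimately have "q u k =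
        inner (S u - h) (S u - h) + (inner (S u) r + inner (S u) h + inner h (S u) + inner (T h) h)"
      by (simp only: q_def) (simp add: k_eq inner_add_left inner_add_right)
    also have "\<dots> = inner (S u) (S u) + inner (S u) r + e h"
      using inner_commute[of h "S u"] by (simp add: e_def inner_diff_left inner_diff_right)
    also have "inner (S u) (S u) + inner (S u) r = inner (S u) u"
      by (simp add: r_def inner_diff_right)
    finally show ?thesis by (simp only: h_def r_def)
  qed
  \<comment> \<open>The minimizer r is only known to lie in \<open>K\<close>. It is approximated by
    vectors \<open>j (Y n)\<close>, along which the excess \<open>e\<close> tends to 0.\<close>
  have INF_eq: "(INF y. q (j x) (j y)) = inner (S (j x)) (j x)" for x
  proof -
    define r where "r = j x - S (j x)"
    have r: "r \<in> K" by (simp add: r_def diff_in_K SK)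
    have q_ge: "inner (S (j x)) (j x) \<le> q (j x) (j y)" for y
    proof -
      have "j y - r \<in> K" by (simp add: r diff_in_K)
      then have "0 \<le> e (j y - r)"
        using positive_opsD(2)[OF T] by (simp add: e_def)
      then show ?thesis by (simp add: q_eq r_def)
    qed
    then have bdd: "bdd_below (range (\<lambda>y. q (j x) (j y)))"
      by (intro bdd_belowI2)
    obtain X where X: "\<And>n. X n \<in> range j" and lim: "X \<longlonglongrightarrow> r"
      using r unfolding closure_range_j[symmetric] closure_sequential by blast
    have "\<exists>y. X n = j y" for n using X[of n] by auto
    then obtain Y where Y: "\<And>n. X n = j (Y n)" by metis
    have "X = (\<lambda>n. j (Y n))" by (rule ext) (rule Y)
    then have lim: "(\<lambda>n. j (Y n)) \<longlonglongrightarrow> r" using lim by (simp only:)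
    have YK: "j (Y n) - r \<in> K" for n by (simp add: r diff_in_K)
    have zero: "(\<lambda>n. j (Y n) - r) \<longlonglongrightarrow> 0" by (rule LIM_zero[OF lim])
    have "(0::'k) \<in> K" using csubspace_K by (simp add: closed_csubspace_def)
    then have "(\<lambda>n. T (j (Y n) - r)) \<longlonglongrightarrow> T 0"
      by (rule bounded_ops_tendsto[OF positive_opsD(1)[OF T] csubspace_K YK _ zero])
    then have "(\<lambda>n. inner (S (j x)) (j x) + e (j (Y n) - r)) \<longlonglongrightarrow>
        inner (S (j x)) (j x) + (inner (0::'k) 0 + inner (T 0) 0)"
      unfolding e_def by (intro tendsto_add tendsto_const tendsto_inner zero)
    then have "(\<lambda>n. q (j x) (j (Y n))) \<longlonglongrightarrow> inner (S (j x)) (j x)"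
      by (simp add: q_eq r_def)
    then have "(INF y. q (j x) (j y)) \<le> inner (S (j x)) (j x)"
      by (rule LIMSEQ_le_const) (intro exI[of _ 0] allI impI cINF_lower[OF bdd] UNIV_I)
    moreover have "inner (S (j x)) (j x) \<le> (INF y. q (j x) (j y))"
      by (rule cINF_greatest) (simp_all add: q_ge)
    ultimately show ?thesis by simp
  qed
  have form: "cinner (\<Psi> S x) x = complex_of_real
      (INF y. Re (cinner (B (x - y)) (x - y)) + Re (cinner (\<Psi> T y) y))" for x
  proof -
    have "Re (cinner (B (x - y)) (x - y)) + Re (cinner (\<Psi> T y) y) = q (j x) (j y)" for y
      by (simp add: q_def inner_eq_Re_cinner cinner_j cinner_Psi[OF positive_opsD(1)[OF T]]
          flip: j_diff)
    moreover have "cinner (\<Psi> S x) x = complex_of_real (inner (S (j x)) (j x))"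
      by (simp add: cinner_Psi[OF S] positive_opsD(3)[OF \<open>S \<in> positive_ops K\<close>])
    ultimately show ?thesis by (simp only: INF_eq)
  qed
  show ?thesis
    unfolding parallel_sum_def
  proof (rule the_equality)
    fix C assume C: "C \<in> positive_ops UNIV \<and> (\<forall>x. cinner (C x) x = complex_of_real
      (INF y. Re (cinner (B (x - y)) (x - y)) + Re (cinner (\<Psi> T y) y)))"
    show "C = \<Psi> S"
    proof (rule positive_ops_eqI)
      show "cinner (C x) x = cinner (\<Psi> S x) x" for x
        unfolding form using C by blast
    qed (use C pos in blast)+
  next
    show "\<Psi> S \<in> positive_ops UNIV \<and> (\<forall>x. cinner (\<Psi> S x) x = complex_of_real
      (INF y. Re (cinner (B (x - y)) (x - y)) + Re (cinner (\<Psi> T y) y)))"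
      by (intro conjI allI pos form)
  qed
qed

text \<open>The equation identifies \<open>S n\<close> as I : n T, so \<open>\<Psi> (S n)\<close> is
  the parallel sum of \<open>B\<close> and n \<open>\<Psi> T\<close>. Continuity of \<open>J\<close>
  carries the pointwise limit from \<open>K\<close> to H.\<close>

lemma gen_short_Psi:
  assumes T: "T \<in> positive_ops K" and P: "P \<in> bounded_ops K K"
    and S: "\<And>n. S n \<in> bounded_ops K K"
    and eq: "\<And>n u. u \<in> K \<Longrightarrow> S n u + of_nat n *\<^sub>C T (S n u) = of_nat n *\<^sub>C T u"
    and lim: "\<And>u. u \<in> K \<Longrightarrow> (\<lambda>n. S n u) \<longlonglongrightarrow> P u"
  shows "gen_short (\<Psi> T) B = \<Psi> P"
proof
  fix x
  have "parallel_sum B (\<lambda>y. of_nat n *\<^sub>C \<Psi> T y) = \<Psi> (S n)" for n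
  proof -
    have scaled: "(\<lambda>y. of_nat n *\<^sub>C \<Psi> T y) = \<Psi> (\<lambda>u\<in>K. of_nat n *\<^sub>C T u)"
      by (rule ext) (simp add: Psi_scaled[OF positive_opsD(1)[OF T]])
    show ?thesis
      unfolding scaled
    proof (rule parallel_sum_Psi[OF positive_ops_scaled[OF T csubspace_K] S])
      show "S n u + (\<lambda>u\<in>K. of_nat n *\<^sub>C T u) (S n u) = (\<lambda>u\<in>K. of_nat n *\<^sub>C T u) u"
        if "u \<in> K" for u
        using that eq[OF that, of n] bounded_opsD(1)[OF S csubspace_K that] by simp
    qed
  qed
  moreover have "(\<lambda>n. J (S n (j x))) \<longlonglongrightarrow> J (P (j x))"
  proof (rule bounded_ops_tendsto[OF J_bounded csubspace_K])
    show "S n (j x) \<in> K" for n by (rule bounded_opsD(1)[OF S csubspace_K j_in_K])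
    show "P (j x) \<in> K" by (rule bounded_opsD(1)[OF P csubspace_K j_in_K])
    show "(\<lambda>n. S n (j x)) \<longlonglongrightarrow> P (j x)" by (rule lim[OF j_in_K])
  qed
  ultimately show "gen_short (\<Psi> T) B x = \<Psi> P x"
    by (simp only: gen_short_def Psi_apply) (rule limI)
qed

section \<open>Projections and quasi-units\<close>

lemma Psi_orth_projection_quasi_unit:
  assumes P: "P \<in> orth_projections K"
  shows "\<Psi> P \<in> quasi_units B"
proof -
  have P': "P \<in> bounded_ops K K" and idem: "\<And>u. u \<in> K \<Longrightarrow> P (P u) = P u"
    and sym: "\<And>u v. u \<in> K \<Longrightarrow> v \<in> K \<Longrightarrow> cinner (P u) v = cinner u (P v)"
    using P by (auto simp: orth_projections_def)
  note D = bounded_opsD[OF P' csubspace_K]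
  have pos: "P \<in> positive_ops K" by (rule orth_projections_positive[OF P csubspace_K])
  \<comment> \<open>The complement I - P is again an orthogonal projection, hence positive.\<close>
  have "op_le K P (\<lambda>u\<in>K. u)"
    unfolding op_le_def
  proof (rule orth_projections_positive[OF _ csubspace_K])
    have "(\<lambda>u\<in>K. (\<lambda>u\<in>K. u) u - P u) \<in> bounded_ops K K"
      by (rule bounded_ops_diff[OF id_bounded P' csubspace_K csubspace_K])
    then show "(\<lambda>u\<in>K. (\<lambda>u\<in>K. u) u - P u) \<in> orth_projections K"
      by (simp add: orth_projections_def diff_in_K D idem sym cinner_diff_left cinner_diff_right)
  qed
  then have le: "op_le UNIV (\<Psi> P) B"
    using op_le_Psi_iff[OF P' id_bounded] by (simp add: Psi_id)
  \<comment> \<open>On the range of a projection I + n P is multiplication by n + 1, so I : n P is n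
    / (n + 1) times \<open>P\<close>.\<close>
  define S where "S n = (\<lambda>u\<in>K. complex_of_real (real n / real (Suc n)) *\<^sub>C P u)" for n
  have "gen_short (\<Psi> P) B = \<Psi> P"
  proof (rule gen_short_Psi[OF pos P', of S])
    show "S n \<in> bounded_ops K K" for n
      unfolding S_def by (rule bounded_ops_scaled[OF P' csubspace_K csubspace_K])
    show "S n u + of_nat n *\<^sub>C P (S n u) = of_nat n *\<^sub>C P u" if u: "u \<in> K" for n u
    proof -
      have "S n u + of_nat n *\<^sub>C P (S n u) =
          complex_of_real (real n / real (Suc n) + real n * (real n / real (Suc n))) *\<^sub>C P u"
        using u by (simp add: S_def D idem scaleC_in_K scaleC_scaleC flip: scaleC_add_left)
      also have "real n / real (Suc n) + real n * (real n / real (Suc n)) =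
          real (Suc n) * (real n / real (Suc n))"
        by (simp only: of_nat_Suc distrib_right mult_1)
      also have "\<dots> = real n"
        by (simp del: of_nat_Suc)
      finally show ?thesis by simp
    qed
    show "(\<lambda>n. S n u) \<longlonglongrightarrow> P u" if u: "u \<in> K" for u
    proof -
      have "(\<lambda>n. (real n / real (Suc n)) *\<^sub>R P u) \<longlonglongrightarrow> P u"
        using tendsto_scaleR[OF LIMSEQ_n_over_Suc_n tendsto_const[of "P u"]]
        by (simp only: scaleR_one)
      then show ?thesis using u by (simp only: S_def scaleR_scaleC restrict_apply if_True)
    qed
  qed
  then show ?thesis
    using le pos by (simp add: quasi_units_def Psi_positive_iff[OF P'])
qed

text \<open>Douglas' lemma is applied twice, stripping one factor each time: A = J V, then V is the
  adjoint of \<open>T\<close> composed with \<open>J\<close>. The first application needs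
  \<open>A x\<close> dominated by \<open>j x\<close>, the second needs \<open>V x\<close> dominated
  by \<open>j x\<close>.\<close>

lemma Psi_surj_below_B:
  assumes A: "A \<in> positive_ops UNIV" and le: "op_le UNIV A B"
  obtains T where "T \<in> positive_ops K" "\<Psi> T = A"
proof -
  note DA = bounded_opsD[OF positive_opsD(1)[OF A] closed_csubspace_UNIV]
  have A_le: "inner (A x) x \<le> (norm (j x))\<^sup>2" for x
    using positive_opsD(2)[OF le[unfolded op_le_def], of x]
    by (simp add: inner_diff_left power2_norm_eq_inner inner_j)
  have A_ge: "0 \<le> inner (A x) x" for x by (rule positive_opsD(2)[OF A UNIV_I])
  have CS: "(inner (A x) y)\<^sup>2 \<le> inner (A x) x * inner (A y) y" for x y
    by (rule positive_ops_Cauchy_Schwarz[OF A closed_csubspace_UNIV UNIV_I UNIV_I])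
  have sym: "inner (A x) y = inner x (A y)" for x y
    by (rule positive_ops_symmetric[OF A closed_csubspace_UNIV UNIV_I UNIV_I])
  \<comment> \<open>Cauchy-Schwarz for the form of \<open>A\<close>, followed by \<open>A\<close>
    \<le> \<open>B\<close>; this bounds the form in both variables by the norm of
    \<open>K\<close>.\<close>
  have form_le: "inner x (A y) \<le> norm (j x) * norm (j y)" for x y
  proof -
    have "(inner (A x) y)\<^sup>2 \<le> (norm (j x))\<^sup>2 * (norm (j y))\<^sup>2"
      by (rule order_trans[OF CS mult_mono[OF A_le A_le]]) (simp_all add: A_ge)
    then have "(inner x (A y))\<^sup>2 \<le> (norm (j x) * norm (j y))\<^sup>2"
      by (simp only: sym power_mult_distrib)
    then show ?thesis by (rule power2_le_imp_le) simp
  qed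
  obtain M where M: "M \<ge> 0" "\<And>x. x \<in> UNIV \<Longrightarrow> norm (A x) \<le> M * norm x"
    by (rule bounded_ops_bound[OF positive_opsD(1)[OF A]]) (rule that)
  \<comment> \<open>Cauchy-Schwarz for the form of \<open>A\<close> at x and \<open>A x\<close>
    bounds the fourth power of the norm of \<open>A x\<close>; one square cancels unless
    \<open>A x\<close> = 0. The constant comes from the norm bound \<open>M\<close> of
    \<open>A\<close>.\<close>
  have A_bound: "norm (A x) \<le> sqrt M * norm (j x)" for x
  proof -
    have "inner (A (A x)) (A x) \<le> norm (A (A x)) * norm (A x)"
      by (rule norm_cauchy_schwarz)
    also have "\<dots> \<le> M * norm (A x) * norm (A x)"
      by (rule mult_right_mono[OF M(2)]) simp_all
    finally have AA: "inner (A (A x)) (A x) \<le> M * (norm (A x))\<^sup>2"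
      by (simp only: power2_eq_square mult.assoc)
    have "((norm (A x))\<^sup>2)\<^sup>2 = (inner (A x) (A x))\<^sup>2"
      by (simp only: power2_norm_eq_inner)
    also have "\<dots> \<le> inner (A x) x * inner (A (A x)) (A x)" by (rule CS)
    also have "\<dots> \<le> (norm (j x))\<^sup>2 * (M * (norm (A x))\<^sup>2)"
      by (rule mult_mono[OF A_le AA]) (simp_all add: A_ge)
    finally have le: "(norm (A x))\<^sup>2 * (norm (A x))\<^sup>2 \<le> (M * (norm (j x))\<^sup>2) * (norm (A x))\<^sup>2"
      by (simp add: power2_eq_square ac_simps)
    have "(norm (A x))\<^sup>2 \<le> M * (norm (j x))\<^sup>2 \<or> A x = 0"
      by (rule disjCI) (rule mult_right_le_imp_le[OF le], simp)
    then have "(norm (A x))\<^sup>2 \<le> (sqrt M * norm (j x))\<^sup>2"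
      using M(1) by (elim disjE) (simp_all add: power_mult_distrib)
    then show ?thesis by (rule power2_le_imp_le) (simp add: M(1))
  qed
  have "clinear_on UNIV A" by (simp add: clinear_on_def DA)
  then obtain V where V: "V \<in> bounded_ops UNIV (closure (range j))"
    and cV: "\<And>x y. cinner (V x) (j y) = cinner x (A y)"
    by (rule douglas[OF clinear_j _ _ A_bound]) (simp add: M(1), rule that)
  note DV = bounded_opsD[OF V[unfolded closure_range_j] closed_csubspace_UNIV]
  have V_bound: "norm (V x) \<le> 1 * norm (j x)" for x
  proof -
    have "inner (V x) (j y) \<le> norm (j x) * norm (j y)" for y
      using form_le[of x y] by (simp only: inner_eq_Re_cinner cV)
    then show ?thesis
      using norm_le_if_inner_le_on_range[of "V x" j "norm (j x)"] DV(1)[OF UNIV_I]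
      by (simp add: closure_range_j)
  qed
  have "clinear_on UNIV V" by (simp add: clinear_on_def DV)
  then obtain T where T: "T \<in> bounded_ops UNIV (closure (range j))"
    and cT: "\<And>u x. cinner (T u) (j x) = cinner u (V x)"
    by (rule douglas[OF clinear_j _ _ V_bound]) (simp, rule that)
  have TK: "T u \<in> K" for u
    using bounded_opsD(1)[OF T closed_csubspace_UNIV UNIV_I] by (simp only: closure_range_j)
  have "T \<in> bounded_ops UNIV UNIV"
    using T by (simp add: bounded_ops_def)
  then have bounded: "restrict T K \<in> bounded_ops K K"
    by (rule bounded_ops_restrict[OF _ csubspace_K]) (rule TK)
  have Psi_T: "\<Psi> (restrict T K) = A"
  proof
    fix x
    have "inner (\<Psi> (restrict T K) x) y = inner (A x) y" for y
    proof -
      have "inner (\<Psi> (restrict T K) x) y = inner (j x) (V y)"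
        by (simp add: inner_eq_Re_cinner cinner_Psi[OF bounded] cT)
      also have "\<dots> = inner (V y) (j x)" by (rule inner_commute)
      also have "\<dots> = inner y (A x)" by (simp add: inner_eq_Re_cinner cV)
      finally show ?thesis by (simp only: inner_commute)
    qed
    then have "inner (\<Psi> (restrict T K) x - A x) (\<Psi> (restrict T K) x - A x) = 0"
      by (simp only: inner_diff_left diff_self)
    then show "\<Psi> (restrict T K) x = A x" by simp
  qed
  have "restrict T K \<in> positive_ops K"
    using A Psi_positive_iff[OF bounded] by (simp only: Psi_T)
  then show ?thesis by (rule that[OF _ Psi_T])
qed

text \<open>The component z of u orthogonal to the range is killed by \<open>T\<close>, hence by
  each \<open>S n\<close>. On vectors T w the error is at most the norm of w divided by n.
  Contractivity of all \<open>S n\<close> extends the convergence to the closure of the range, where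
  \<open>P u\<close> lies.\<close>

lemma parallel_sum_id_tendsto:
  assumes T: "T \<in> positive_ops K" and S: "\<And>n. S n \<in> bounded_ops K K"
    and eq: "\<And>n u. u \<in> K \<Longrightarrow> S n u + of_nat n *\<^sub>C T (S n u) = of_nat n *\<^sub>C T u"
    and norm_S: "\<And>n u. u \<in> K \<Longrightarrow> norm (S n u) \<le> norm u"
    and P: "P \<in> bounded_ops K (closure (range (\<lambda>x. T (j x))))"
    and orth: "\<And>u x. u \<in> K \<Longrightarrow> inner (P u) (T (j x)) = inner u (T (j x))"
    and u: "u \<in> K"
  shows "(\<lambda>n. S n u) \<longlonglongrightarrow> P u"
proof -
  note DT = bounded_opsD[OF positive_opsD(1)[OF T] csubspace_K]
  note DS = bounded_opsD[OF S csubspace_K]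
  define Tn where "Tn n = (\<lambda>u\<in>K. of_nat n *\<^sub>C T u)" for n
  have Tn: "Tn n \<in> positive_ops K" for n
    unfolding Tn_def by (rule positive_ops_scaled[OF T csubspace_K])
  have "range (\<lambda>x. T (j x)) \<subseteq> K" by (auto simp: DT(1))
  then have sub: "closure (range (\<lambda>x. T (j x))) \<subseteq> K"
    using csubspace_K by (simp add: closure_minimal closed_csubspace_def)
  have PR: "P u \<in> closure (range (\<lambda>x. T (j x)))"
    by (rule bounded_opsD(1)[OF P csubspace_K u])
  have PK: "P u \<in> K" by (rule subsetD[OF sub PR])
  define z where "z = u - P u"
  have z: "z \<in> K" unfolding z_def by (rule diff_in_K[OF u PK])
  have "T z = 0"
  proof (rule eq_in_K)
    show "(0::'k) \<in> K" using csubspace_K by (simp add: closed_csubspace_def)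
    show "inner (T z) (j x) = inner 0 (j x)" for x
      using positive_ops_symmetric[OF T csubspace_K z j_in_K, of x] orth[OF u, of x]
      by (simp add: z_def inner_diff_left)
  qed (rule DT(1)[OF z])
  have Sz: "S n z = 0" for n
  proof -
    have "S n z + Tn n (S n z) = 0"
      using eq[OF z, of n] by (simp add: Tn_def DS(1)[OF z] \<open>T z = 0\<close>)
    with inner_add_positive_ge(2)[OF Tn DS(1)[OF z, of n], of n] show ?thesis by simp
  qed
  \<comment> \<open>The n-fold error n (T w - S n (T w)) equals \<open>S n w\<close>: both solve v +
    n T v = n T w, whose solution is unique. Contractivity bounds \<open>S n w\<close>.\<close>
  have ST: "real n * norm (T w - S n (T w)) \<le> norm w" if w: "w \<in> K" for n w
  proof -
    have Tw: "T w \<in> K" by (rule DT(1)[OF w])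
    define r where "r = T w - S n (T w)"
    have r: "r \<in> K" unfolding r_def by (rule diff_in_K[OF Tw DS(1)[OF Tw]])
    have nr: "of_nat n *\<^sub>C r \<in> K" by (rule scaleC_in_K[OF r])
    have "r + of_nat n *\<^sub>C T r = T w"
      using eq[OF Tw, of n]
      by (simp add: r_def DT(3)[OF Tw DS(1)[OF Tw]] scaleC_diff_right algebra_simps)
    then have "of_nat n *\<^sub>C (r + of_nat n *\<^sub>C T r) = of_nat n *\<^sub>C T w" by simp
    then have "of_nat n *\<^sub>C r + Tn n (of_nat n *\<^sub>C r) = S n w + Tn n (S n w)"
      using eq[OF w, of n]
      by (simp add: Tn_def nr DS(1)[OF w] scaleC_add_right DT(4)[OF r])
    then have "of_nat n *\<^sub>C r = S n w"
      by (rule add_positive_inj[OF Tn nr DS(1)[OF w]])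
    then show ?thesis
      using norm_S[OF w, of n] norm_scaleC[of "of_nat n" r] by (simp add: r_def)
  qed
  have "(\<lambda>n. S n (P u)) \<longlonglongrightarrow> P u"
  proof (rule LIMSEQ_I)
    fix e :: real assume e: "e > 0"
    \<comment> \<open>The final estimate has three terms below e / 4: \<open>P u - T (j y)\<close>,
      its image under \<open>S n\<close>, and the error of \<open>S n\<close> at
      \<open>T (j y)\<close>.\<close>
    obtain y where "dist (T (j y)) (P u) < e / 4"
      using PR e by (auto simp: closure_approachable dest!: spec[of _ "e / 4"])
    then have y: "norm (P u - T (j y)) < e / 4" by (simp add: dist_norm norm_minus_commute)
    obtain N :: nat where N: "norm (j y) < real N * (e / 4)"
      using ex_less_of_nat_mult[of "e / 4" "norm (j y)"] e by auto
    have "norm (S n (P u) - P u) < e" if n: "n \<ge> N" for n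
    proof -
      have Ty: "T (j y) \<in> K" by (rule DT(1)[OF j_in_K])
      have d: "P u - T (j y) \<in> K" by (rule diff_in_K[OF PK Ty])
      have "real n * norm (T (j y) - S n (T (j y))) \<le> norm (j y)" by (rule ST[OF j_in_K])
      also have "\<dots> < real N * (e / 4)" by (rule N)
      also have "\<dots> \<le> real n * (e / 4)" using n e by (intro mult_right_mono) simp_all
      finally have small: "norm (T (j y) - S n (T (j y))) < e / 4"
        by (rule mult_left_less_imp_less) simp
      have "S n (P u) - P u =
          S n (P u - T (j y)) - (P u - T (j y)) - (T (j y) - S n (T (j y)))"
        by (simp add: DS(3)[OF PK Ty])
      also have "norm \<dots> \<le> norm (S n (P u - T (j y))) + norm (P u - T (j y)) +
          norm (T (j y) - S n (T (j y)))"
        by (rule order_trans[OF norm_triangle_ineq4 add_right_mono[OF norm_triangle_ineq4]])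
      also have "\<dots> < e" using norm_S[OF d, of n] y small e by linarith
      finally show ?thesis .
    qed
    then show "\<exists>N. \<forall>n\<ge>N. norm (S n (P u) - P u) < e" by blast
  qed
  moreover have "S n u = S n (P u)" for n
    using DS(2)[OF z PK, of n] Sz[of n] by (simp add: z_def)
  ultimately show ?thesis by (simp only:)
qed

text \<open>The operators I : n T converge to the projection onto the closure of the range of T j,
  so [A]B is the image of that projection. The equation A = [A]B then hands the projection to
  \<open>A\<close>.\<close>

lemma quasi_unit_eq_Psi:
  assumes "A \<in> quasi_units B"
  obtains P where "P \<in> orth_projections K" "A = \<Psi> P"
proof -
  have A: "A \<in> positive_ops UNIV" "op_le UNIV A B" and short: "A = gen_short A B"
    using assms by (simp_all add: quasi_units_def)
  obtain T where T: "T \<in> positive_ops K" and A_eq: "\<Psi> T = A"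
    by (rule Psi_surj_below_B[OF A]) (rule that)
  note DT = bounded_opsD[OF positive_opsD(1)[OF T] csubspace_K]
  have Tj: "clinear_on UNIV (\<lambda>x. T (j x))"
    by (simp add: clinear_on_def j_add j_scaleC DT)
  obtain P where P: "P \<in> bounded_ops UNIV (closure (range (\<lambda>x. T (j x))))"
    "P \<in> orth_projections UNIV"
    and orth: "\<And>u x. inner (P u) (T (j x)) = inner u (T (j x))"
    by (rule orth_projection_closure_range[OF Tj]) (rule that)
  have "range (\<lambda>x. T (j x)) \<subseteq> K" by (auto simp: DT(1))
  then have sub: "closure (range (\<lambda>x. T (j x))) \<subseteq> K"
    using csubspace_K by (simp add: closure_minimal closed_csubspace_def)
  have PR: "P u \<in> closure (range (\<lambda>x. T (j x)))" for u
    by (rule bounded_opsD(1)[OF P(1) closed_csubspace_UNIV UNIV_I])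
  have PK: "P u \<in> K" for u by (rule subsetD[OF sub PR])
  have P': "P \<in> bounded_ops UNIV UNIV" using P(2) by (simp add: orth_projections_def)
  have PKK: "restrict P K \<in> bounded_ops K K"
    by (rule bounded_ops_restrict[OF P' csubspace_K PK])
  have proj: "restrict P K \<in> orth_projections K"
    using P(2) PK PKK by (simp add: orth_projections_def)
  have "\<exists>S. S \<in> bounded_ops K K \<and>
      (\<forall>u\<in>K. S u + of_nat n *\<^sub>C T (S u) = of_nat n *\<^sub>C T u \<and> norm (S u) \<le> norm u)" for n
  proof -
    obtain S where S: "S \<in> bounded_ops K K"
      "\<And>u. u \<in> K \<Longrightarrow> S u + (\<lambda>u\<in>K. of_nat n *\<^sub>C T u) (S u) = (\<lambda>u\<in>K. of_nat n *\<^sub>C T u) u"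
      "\<And>u. u \<in> K \<Longrightarrow> norm (S u) \<le> norm u"
      by (rule parallel_sum_id_ex[OF positive_ops_scaled[OF T csubspace_K, of n]]) (rule that)
    have "S u + of_nat n *\<^sub>C T (S u) = of_nat n *\<^sub>C T u" if "u \<in> K" for u
      using S(2)[OF that] that bounded_opsD(1)[OF S(1) csubspace_K that] by simp
    then show ?thesis using S(1,3) by blast
  qed
  then obtain S where S: "\<And>n. S n \<in> bounded_ops K K"
    and eq: "\<And>n u. u \<in> K \<Longrightarrow> S n u + of_nat n *\<^sub>C T (S n u) = of_nat n *\<^sub>C T u"
    and norm_S: "\<And>n u. u \<in> K \<Longrightarrow> norm (S n u) \<le> norm u"
    by metis
  have "gen_short (\<Psi> T) B = \<Psi> (restrict P K)"
  proof (rule gen_short_Psi[OF T PKK S eq])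
    show "(\<lambda>n. S n u) \<longlonglongrightarrow> restrict P K u" if "u \<in> K" for u
    proof (rule parallel_sum_id_tendsto[OF T S eq norm_S _ _ that])
      show "restrict P K \<in> bounded_ops K (closure (range (\<lambda>x. T (j x))))"
        by (rule bounded_ops_restrict[OF P' csubspace_K PR])
      show "inner (restrict P K v) (T (j x)) = inner v (T (j x))" if "v \<in> K" for v x
        using that orth by simp
    qed
  qed
  then have "A = \<Psi> (restrict P K)" using short A_eq by simp
  then show ?thesis by (rule that[OF proj])
qed

end

theorem theorem5:
  fixes B :: "'a::chilbert_space \<Rightarrow> 'a"
    and K :: "'k::chilbert_space set"
    and \<iota> :: "'a \<Rightarrow> 'k"
  assumes "B \<in> positive_ops UNIV"
    and "aux_space B K \<iota>"
  shows "bij_betw (Psi B K \<iota>) (orth_projections K) (quasi_units B) \<and>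
    monotone_on (orth_projections K) (op_le K) (op_le UNIV) (Psi B K \<iota>)"
proof
  interpret aux_completion B K \<iota>
    by unfold_locales (rule assms)+
  have bounded: "P \<in> bounded_ops K K" if "P \<in> orth_projections K" for P
    using that by (simp add: orth_projections_def)
  show "bij_betw (Psi B K \<iota>) (orth_projections K) (quasi_units B)"
    unfolding bij_betw_def
  proof
    show "inj_on (Psi B K \<iota>) (orth_projections K)"
      by (rule inj_onI) (rule Psi_inj[OF bounded bounded])
    show "Psi B K \<iota> ` orth_projections K = quasi_units B"
    proof
      show "Psi B K \<iota> ` orth_projections K \<subseteq> quasi_units B"
        by (rule image_subsetI) (rule Psi_orth_projection_quasi_unit)
      show "quasi_units B \<subseteq> Psi B K \<iota> ` orth_projections K"
      proof
        fix A assume "A \<in> quasi_units B"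
        then obtain P where "P \<in> orth_projections K" "A = Psi B K \<iota> P"
          by (rule quasi_unit_eq_Psi)
        then show "A \<in> Psi B K \<iota> ` orth_projections K" by (simp add: imageI)
      qed
    qed
  qed
  show "monotone_on (orth_projections K) (op_le K) (op_le UNIV) (Psi B K \<iota>)"
    by (rule monotone_onI) (simp add: op_le_Psi_iff bounded)
qed

end
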